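(* Let $f$ be a transcendental real entire function of order $\rho<2$ such that $\mathcal Z(f)\subset\mathbb S=\{z\in\mathbb C: |\operatorname{Im} z|<1/2\}$. Then for every real $c>\rho$ we have $N(f;d)=O(d^{c/2})$ as $d\to\infty$. If moreover $f$ is even, and $f_0$ denotes the entire function with $f(z)=f_0(z^2)$ for all $z\in\mathbb C$, then also $N(f_0;d)=O(d^{c/2})$ as $d\to\infty$ for every real $c>\rho$.
   Context: For an entire function $g$: $\mathcal Z(g)=\{z\in\mathbb C: g(z)=0\}$. The order of $g$ is $\limsup_{r\to\infty}\frac{\log\log M(r;g)}{\log r}$, where $M(r;g)=\max_{|z|=r}|g(z)|$. $g$ is called real if $g^{(n)}(0)\in\mathbb R$ for all $n\ge 0$. $g$ is transcendental if it is not a polynomial. A real polynomial is hyperbolic if all its zeros in $\mathbb C$ are real; by convention, constant polynomials, including the zero polynomial, count as hyperbolic. For a real entire function $g$ and a positive integer $d$, the $d$-th Jensen polynomial of $g$ is $J(g;d)(z)=\sum_{k=0}^d\binom dk g^{(k)}(0)z^k$. If there is a non-negative integer $N$ such that $J(g^{(n)};d)$ is hyperbolic for every integer $n\ge N$, then $N(g;d)$ denotes the smallest such $N$; otherwise $N(g;d)=\infty$. (An estimate $N(g;d)=O(d^{c/2})$ as $d\to\infty$ includes the assertion that $N(g;d)$ is finite for all sufficiently large $d$.) *)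

theory Defs
  imports
    "HOL-Complex_Analysis.Complex_Analysis"
    "HOL-Computational_Algebra.Polynomial"
    "HOL-Library.Landau_Symbols"
    "HOL-Library.Extended_Nat"
begin

definition zero_set :: "(complex \<Rightarrow> complex) \<Rightarrow> complex set" where
  "zero_set g = {z. g z = 0}"

text \<open>For continuous \<open>g\<close> and \<open>r \<ge> 0\<close> the supremum is a maximum, the sphere being compact.\<close>

definition max_modulus :: "real \<Rightarrow> (complex \<Rightarrow> complex) \<Rightarrow> real" where
  "max_modulus r g = (SUP z\<in>sphere 0 r. norm (g z))"

text \<open>For transcendental entire \<open>g\<close> one has \<open>max_modulus r g > 1\<close> for all large \<open>r\<close>, so the
  values of \<^const>\<open>ln\<close> at nonpositive arguments do not affect the limit superior.\<close>

definition growth_order :: "(complex \<Rightarrow> complex) \<Rightarrow> ereal" where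
  "growth_order g = Limsup at_top (\<lambda>r. ereal (ln (ln (max_modulus r g)) / ln r))"

definition real_entire :: "(complex \<Rightarrow> complex) \<Rightarrow> bool" where
  "real_entire g \<longleftrightarrow> g holomorphic_on UNIV \<and> (\<forall>n. (deriv ^^ n) g 0 \<in> \<real>)"

definition transcendental :: "(complex \<Rightarrow> complex) \<Rightarrow> bool" where
  "transcendental g \<longleftrightarrow> \<not> (\<exists>p. g = poly p)"

text \<open>Real polynomials are represented as complex polynomials with real coefficients. The
  disjunct \<open>degree p = 0\<close> matters only for the zero polynomial, which is hyperbolic by convention.\<close>

definition hyperbolic :: "complex poly \<Rightarrow> bool" where
  "hyperbolic p \<longleftrightarrow>
     (\<forall>i. coeff p i \<in> \<real>) \<and> (degree p = 0 \<or> (\<forall>z. poly p z = 0 \<longrightarrow> z \<in> \<real>))"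

definition jensen_poly :: "(complex \<Rightarrow> complex) \<Rightarrow> nat \<Rightarrow> complex poly" where
  "jensen_poly g d = (\<Sum>k\<le>d. monom (of_nat (d choose k) * (deriv ^^ k) g 0) k)"

definition hyperbolic_from :: "(complex \<Rightarrow> complex) \<Rightarrow> nat \<Rightarrow> nat \<Rightarrow> bool" where
  "hyperbolic_from g d N \<longleftrightarrow> (\<forall>n\<ge>N. hyperbolic (jensen_poly ((deriv ^^ n) g) d))"

definition jensen_N :: "(complex \<Rightarrow> complex) \<Rightarrow> nat \<Rightarrow> enat" where
  "jensen_N g d =
     (if \<exists>N. hyperbolic_from g d N then enat (LEAST N. hyperbolic_from g d N) else \<infinity>)"

text \<open>The value of \<^const>\<open>the_enat\<close> at \<open>\<infinity>\<close> is irrelevant because of the first conjunct.\<close>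

definition enat_bigo :: "(nat \<Rightarrow> enat) \<Rightarrow> (nat \<Rightarrow> real) \<Rightarrow> bool" where
  "enat_bigo F h \<longleftrightarrow>
     (\<forall>\<^sub>F d in sequentially. F d \<noteq> \<infinity>) \<and> (\<lambda>d. real (the_enat (F d))) \<in> O(h)"

end

theory Submission
  imports Defs "HOL-Computational_Algebra.Fundamental_Theorem_Algebra"
begin

text \<open>
  Write \<open>D\<close> for differentiation. Reversing the order of the coefficients turns the \<open>d\<close>-th Jensen
  polynomial of \<open>f\<^sup>(\<^sup>n\<^sup>)\<close> into \<open>f\<^sup>(\<^sup>n\<^sup>)(D) x\<^sup>d\<close>. An operator \<open>D - a\<close> with real \<open>a\<close> keeps all zeros of
  a polynomial real, and the operator \<open>(D - a)\<^sup>2 + b\<^sup>2\<close> that belongs to a pair of zeros \<open>a \<plusminus> ib\<close> does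
  so on polynomials of degree at most \<open>d\<close> as soon as \<open>(d - 1) b\<^sup>2 \<le> a\<^sup>2\<close>
  (\<open>real_rooted_quadratic_operator\<close>). So \<open>n\<close> only has to be so large that every nonreal zero \<open>w\<close> of
  \<open>f\<^sup>(\<^sup>n\<^sup>)\<close> satisfies \<open>(d - 1) (Im w)\<^sup>2 \<le> (Re w)\<^sup>2\<close>; when the zeros stay in a strip, it suffices that
  none of them is nonreal with \<open>|w|\<close> below a constant multiple of \<open>\<surd>d\<close>.

  Differentiation drives the nonreal zeros away from the origin. By Jensen's theorem a nonreal zero
  of a derivative lies in a disc that has a pair of conjugate zeros of the function as the ends of
  a diameter. Hence a nonreal zero \<open>w\<close> of \<open>f\<^sup>(\<^sup>n\<^sup>)\<close> ends a chain \<open>z\<^sub>0, \<dots>, z\<^sub>n = w\<close> with \<open>f\<^sup>(\<^sup>k\<^sup>)(z\<^sub>k) = 0\<close> in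
  which the heights \<open>|Im z\<^sub>k|\<close> do not increase and the squares of the step lengths telescope, so that the
  whole chain has length at most \<open>\<surd>(2n) |Im z\<^sub>0|\<close> (\<open>zero_chain_length\<close>). A function whose
  successive derivatives vanish at points so close together must be small: Gontcharoff's iterated
  integral bounds \<open>|f(x)|\<close> by \<open>D\<^sup>n/n!\<close> times the maximum of \<open>|f\<^sup>(\<^sup>n\<^sup>)|\<close> on a disc of radius
  \<open>D = |x| + |w| + 2 \<surd>(2n) |Im z\<^sub>0|\<close>, and Cauchy's inequality turns this into
  \<open>|f(x)| \<le> 9\<^sup>-\<^sup>n max {|f(z)|. |z| \<le> 10 D}\<close> (\<open>nonreal_zero_of_higher_derivative\<close>). If
  \<open>|f(z)| \<le> A exp (|z|\<^sup>\<sigma>)\<close> and \<open>(10 D)\<^sup>\<sigma> \<le> n\<close>, the right side is at most \<open>A (e/9)\<^sup>n\<close>, which for large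
  \<open>n\<close> contradicts \<open>f(x) \<noteq> 0\<close>. So \<open>10 D > n\<^sup>1\<^sup>/\<^sup>\<sigma>\<close>. For zeros of \<open>f\<close> in a strip and \<open>\<sigma> < 2\<close> the term
  \<open>\<surd>n\<close> is negligible, \<open>|w|\<close> is at least of the order of \<open>n\<^sup>1\<^sup>/\<^sup>\<sigma>\<close>, and this exceeds a multiple of
  \<open>\<surd>d\<close> once \<open>n\<close> exceeds a multiple of \<open>d\<^sup>\<sigma>\<^sup>/\<^sup>2\<close> (\<open>strip_hyperbolic\<close>).

  For even \<open>f\<close> the same estimate is applied to \<open>f\<^sub>0\<close>. It grows with half the exponent, and its zeros,
  being squares of points of the strip, lie in the parabolic region \<open>(Im w)\<^sup>2 \<le> |w|\<close>; there the
  displacement along a chain is controlled by \<open>|w| + n\<close>, and \<open>n\<close> is negligible against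
  \<open>n\<^sup>2\<^sup>/\<^sup>\<sigma>\<close> (\<open>parabola_hyperbolic\<close>).

  All this is carried out for polynomials. A real entire function of order below \<open>2\<close> is a locally
  uniform limit of real polynomials whose nonreal zeros are zeros of the function
  (\<open>polynomial_approximation\<close>): after the zeros in a large disc have been split off, what remains is
  the exponential of a function which, by the inequality of Borel and Caratheodory, is almost affine
  near the origin, and \<open>exp (a z)\<close> is the limit of the real-rooted \<open>(1 + a z / m)\<^sup>m\<close>. Finally,
  real-rootedness survives the passage to the limit.
\<close>

section \<open>Real polynomials and their zeros\<close>

definition real_coeffs :: "complex poly \<Rightarrow> bool" where
  "real_coeffs p \<longleftrightarrow> (\<forall>i. coeff p i \<in> \<real>)"

definition real_rooted :: "complex poly \<Rightarrow> bool" where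
  "real_rooted p \<longleftrightarrow> (\<forall>z. poly p z = 0 \<longrightarrow> z \<in> \<real>)"

lemma real_coeffs_mult: "real_coeffs p \<Longrightarrow> real_coeffs q \<Longrightarrow> real_coeffs (p * q)"
  by (auto simp: real_coeffs_def coeff_mult intro!: sum_in_Reals)

lemma real_coeffs_pderiv: "real_coeffs p \<Longrightarrow> real_coeffs (pderiv p)"
  by (auto simp: real_coeffs_def coeff_pderiv simp del: of_nat_Suc intro!: Reals_mult)

lemma real_coeffs_higher_pderiv: "real_coeffs p \<Longrightarrow> real_coeffs ((pderiv ^^ n) p)"
  by (induction n) (auto intro: real_coeffs_pderiv)

lemma real_coeffs_linear: "real_coeffs [:- of_real a, 1:]"
  by (auto simp: real_coeffs_def coeff_pCons split: nat.splits)

lemma poly_cnj_real_coeffs: "real_coeffs p \<Longrightarrow> poly p (cnj z) = cnj (poly p z)"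
  using poly_cnj_real[of p z] by (simp add: real_coeffs_def)

lemma real_coeffs_cofactor:
  assumes "real_coeffs (q * r)" "real_coeffs q" "q \<noteq> 0"
  shows "real_coeffs r"
proof -
  have eq: "map_poly cnj p = p \<longleftrightarrow> real_coeffs p" for p
    by (auto simp: real_coeffs_def poly_eq_iff coeff_map_poly Reals_cnj_iff)
  have "map_poly cnj (q * r) = map_poly cnj q * map_poly cnj r"
    by (intro poly_eqI) (simp add: coeff_map_poly coeff_mult)
  moreover have "map_poly cnj (q * r) = q * r" "map_poly cnj q = q"
    using assms(1,2) by (simp_all only: eq)
  ultimately have "q * r = q * map_poly cnj r"
    by (simp only:)
  then have "map_poly cnj r = r"
    using assms(3) by (metis mult_left_cancel)
  then show ?thesis
    by (simp only: eq)
qed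

text \<open>The real quadratic polynomial with the zeros \<open>w\<close> and \<open>cnj w\<close>, with its coefficients written out
  because they become those of a differential operator.\<close>

definition conj_quadratic :: "complex \<Rightarrow> complex poly" where
  "conj_quadratic w = [:of_real ((Re w)\<^sup>2 + (Im w)\<^sup>2), - of_real (2 * Re w), 1:]"

lemma conj_quadratic_eq: "conj_quadratic w = [:- w, 1:] * [:- cnj w, 1:]"
  by (auto simp: conj_quadratic_def complex_eq_iff power2_eq_square)

lemma real_coeffs_conj_quadratic: "real_coeffs (conj_quadratic w)"
  by (auto simp: real_coeffs_def conj_quadratic_def coeff_pCons split: nat.splits)

lemma conj_quadratic_nonzero: "conj_quadratic w \<noteq> 0"
  by (simp add: conj_quadratic_def)

lemma degree_conj_quadratic: "degree (conj_quadratic w) = 2"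
  by (simp add: conj_quadratic_def)

lemma real_coeffs_nonreal_root:
  assumes "real_coeffs q" "poly q w = 0" "Im w \<noteq> 0"
  obtains r where "q = conj_quadratic w * r" "real_coeffs r"
proof -
  obtain s where s: "q = [:- w, 1:] * s"
    using assms(2) by (auto simp: poly_eq_0_iff_dvd elim: dvdE)
  have "poly q (cnj w) = 0"
    using assms by (simp add: poly_cnj_real_coeffs)
  moreover have "cnj w \<noteq> w"
    using assms(3) by (auto simp: complex_eq_iff)
  ultimately have "poly s (cnj w) = 0"
    by (simp add: s)
  then obtain r where r: "s = [:- cnj w, 1:] * r"
    by (auto simp: poly_eq_0_iff_dvd elim: dvdE)
  have "q = conj_quadratic w * r"
    by (simp only: s r conj_quadratic_eq mult.assoc)
  moreover from this have "real_coeffs r"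
    using assms(1) real_coeffs_cofactor real_coeffs_conj_quadratic conj_quadratic_nonzero by metis
  ultimately show ?thesis
    using that by blast
qed

lemma real_coeffs_real_root:
  assumes "real_coeffs q" "poly q w = 0" "Im w = 0"
  obtains r where "q = [:- of_real (Re w), 1:] * r" "real_coeffs r"
proof -
  have w: "of_real (Re w) = w"
    using assms(3) by (simp add: complex_eq_iff)
  obtain s where s: "q = [:- of_real (Re w), 1:] * s"
    using assms(2) unfolding w by (auto simp: poly_eq_0_iff_dvd elim: dvdE)
  moreover from this have "real_coeffs s"
    using assms(1) real_coeffs_cofactor real_coeffs_linear by (metis one_neq_zero pCons_eq_0_iff)
  ultimately show ?thesis
    using that by blast
qed

text \<open>With \<open>u\<^sub>i = 1 / (z - r\<^sub>i)\<close> the quotients \<open>P'/P\<close> and \<open>P''/P\<close> are the sum and twice the second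
  elementary symmetric function of the \<open>u\<^sub>i\<close>. This turns statements about zeros of differential expressions
  into statements about points \<open>u\<^sub>i\<close> of a half-plane.\<close>

lemma root_product_log_derivatives:
  fixes r :: "nat \<Rightarrow> complex"
  assumes "\<And>i. i < m \<Longrightarrow> z \<noteq> r i"
  defines "P \<equiv> (\<Prod>i<m. [:- r i, 1:])"
  shows "poly (pderiv P) z = poly P z * (\<Sum>i<m. 1 / (z - r i))"
    and "poly (pderiv (pderiv P)) z =
           poly P z * ((\<Sum>i<m. 1 / (z - r i))\<^sup>2 - (\<Sum>i<m. (1 / (z - r i))\<^sup>2))"
proof -
  have "poly (pderiv (\<Prod>i<m. [:- r i, 1:])) z =
          poly (\<Prod>i<m. [:- r i, 1:]) z * (\<Sum>i<m. 1 / (z - r i)) \<and>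
        poly (pderiv (pderiv (\<Prod>i<m. [:- r i, 1:]))) z =
          poly (\<Prod>i<m. [:- r i, 1:]) z *
            ((\<Sum>i<m. 1 / (z - r i))\<^sup>2 - (\<Sum>i<m. (1 / (z - r i))\<^sup>2))"
    using assms(1)
  proof (induction m)
    case 0
    then show ?case by simp
  next
    case (Suc m)
    then have "z \<noteq> r m" by simp
    then have ne: "z - r m \<noteq> 0" by simp
    let ?L = "[:- r m, 1:]"
    have pL: "poly ?L z = z - r m" "pderiv ?L = 1"
      by (simp_all add: pderiv_pCons)
    define Q where "Q = (\<Prod>i<m. [:- r i, 1:])"
    define s where "s = (\<Sum>i<m. 1 / (z - r i))"
    define t where "t = (\<Sum>i<m. (1 / (z - r i))\<^sup>2)"
    have IH: "poly (pderiv Q) z = poly Q z * s" "poly (pderiv (pderiv Q)) z = poly Q z * (s\<^sup>2 - t)"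
      using Suc by (auto simp: Q_def s_def t_def)
    have P: "(\<Prod>i<Suc m. [:- r i, 1:]) = Q * ?L"
      by (simp add: Q_def)
    have d1: "pderiv (Q * ?L) = Q + ?L * pderiv Q"
      unfolding pderiv_mult pL by simp
    have d2: "pderiv (pderiv (Q * ?L)) = pderiv Q + (pderiv Q + ?L * pderiv (pderiv Q))"
      unfolding d1 pderiv_add pderiv_mult pL
      by (simp del: mult_pCons_left)
    have ne1: "(z - r m) * (1 / (z - r m)) = 1"
      using ne by simp
    define v where "v = 1 / (z - r m)"
    have v: "(z - r m) * v = 1" using ne1 by (simp add: v_def)
    have 1: "poly (pderiv (Q * ?L)) z = poly (Q * ?L) z * (s + v)"
      unfolding d1 using IH v by (simp add: pL algebra_simps) algebra
    have 2: "poly (pderiv (pderiv (Q * ?L))) z = poly (Q * ?L) z * ((s + v)\<^sup>2 - (t + v\<^sup>2))"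
      unfolding d2 poly_add poly_smult poly_mult pL IH using v by algebra
    show ?case
      using 1 2 unfolding P by (simp add: s_def t_def v_def)
  qed
  then show "poly (pderiv P) z = poly P z * (\<Sum>i<m. 1 / (z - r i))"
    and "poly (pderiv (pderiv P)) z =
           poly P z * ((\<Sum>i<m. 1 / (z - r i))\<^sup>2 - (\<Sum>i<m. (1 / (z - r i))\<^sup>2))"
    by (simp_all add: P_def)
qed

lemma root_factorization:
  fixes p :: "complex poly"
  assumes "p \<noteq> 0"
  obtains r where "p = smult (lead_coeff p) (\<Prod>i<degree p. [:- r i, 1:])"
    "\<And>i. i < degree p \<Longrightarrow> poly p (r i) = 0"
proof -
  obtain r where r: "smult (lead_coeff p) (\<Prod>i<degree p. [:- r i, 1:]) = p"
    by (rule complex_poly_decompose')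
  have "poly p (r i) = 0" if "i < degree p" for i
  proof -
    have "poly (\<Prod>i<degree p. [:- r i, 1:]) (r i) = 0"
      unfolding poly_prod using that by (intro prod_zero) auto
    then show ?thesis
      by (subst r[symmetric]) simp
  qed
  with r[symmetric] show ?thesis
    using that by blast
qed

section \<open>Differential operators that keep the zeros real\<close>

text \<open>At a nonreal \<open>z\<close> all terms of the logarithmic derivative \<open>\<Sum> 1 / (z - r\<^sub>i)\<close> have imaginary parts of
  the same sign, so that it cannot take a real value.\<close>

lemma real_rooted_linear_operator:
  assumes "real_rooted g" "pderiv g - smult (of_real a) g \<noteq> 0"
  shows "real_rooted (pderiv g - smult (of_real a) g)"
  unfolding real_rooted_def
proof (intro allI impI, rule ccontr)
  fix z assume z: "poly (pderiv g - smult (of_real a) g) z = 0" "z \<notin> \<real>"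
  have g0: "g \<noteq> 0" using assms(2) by auto
  obtain r where r: "g = smult (lead_coeff g) (\<Prod>i<degree g. [:- r i, 1:])"
    "\<And>i. i < degree g \<Longrightarrow> poly g (r i) = 0"
    using root_factorization[OF g0] by blast
  let ?m = "degree g"
  have rr: "Im (r i) = 0" if "i < ?m" for i
    using r(2)[OF that] assms(1) by (auto simp: real_rooted_def complex_is_Real_iff)
  have Imz: "Im z \<noteq> 0" using z(2) by (simp add: complex_is_Real_iff)
  have zr: "z \<noteq> r i" if "i < ?m" for i
    using rr[OF that] Imz by auto
  have gz: "poly g z \<noteq> 0"
    using assms(1) z(2) by (auto simp: real_rooted_def)
  have "poly (pderiv g) z = poly g z * (\<Sum>i<?m. 1 / (z - r i))"
    using root_product_log_derivatives(1)[of ?m z r] zr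
    by (subst (1 2) r(1)) (simp add: pderiv_smult)
  with z(1) gz have S: "(\<Sum>i<?m. 1 / (z - r i)) = of_real a"
    by simp
  have "?m \<noteq> 0"
  proof
    assume m: "?m = 0"
    with S have "a = 0" by simp
    moreover have "pderiv g = 0" using m by (simp add: pderiv_eq_0_iff)
    ultimately show False using assms(2) by simp
  qed
  have "Im (1 / (z - r i)) = - Im z / (cmod (z - r i))\<^sup>2" if "i < ?m" for i
    using rr[OF that] by (simp add: Im_divide cmod_power2)
  then have "Im (\<Sum>i<?m. 1 / (z - r i)) = (\<Sum>i<?m. - Im z / (cmod (z - r i))\<^sup>2)"
    by simp
  also have "\<dots> = - Im z * (\<Sum>i<?m. 1 / (cmod (z - r i))\<^sup>2)"
    by (simp add: sum_distrib_left)
  also have "\<dots> \<noteq> 0"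
  proof -
    have "(\<Sum>i<?m. 1 / (cmod (z - r i))\<^sup>2) > 0"
      using zr \<open>?m \<noteq> 0\<close> by (intro sum_pos) (auto simp: lessThan_empty_iff)
    then show ?thesis using Imz by simp
  qed
  finally show False using S by simp
qed

text \<open>On pairs \<open>(p, t)\<close> consider the quadratic form \<open>(\<Sum> p\<^sub>i - a t)\<^sup>2 + b\<^sup>2 t\<^sup>2 - \<Sum> p\<^sub>i\<^sup>2\<close>. The condition on
  \<open>a\<close> and \<open>b\<close> leaves it a single positive direction, as in Lorentzian geometry. The form is positive
  at \<open>(q, 0)\<close> when the entries of \<open>q\<close> have a common sign, hence at most \<open>0\<close> at every vector orthogonal
  to \<open>(q, 0)\<close>; the equation in the hypotheses says that \<open>(p, 1)\<close> is such a vector. The number \<open>\<sigma>\<close> only carries the common sign.\<close>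

lemma lorentzian_inequality:
  fixes p q :: "nat \<Rightarrow> real"
  assumes m: "2 \<le> m" and q: "\<And>i. i < m \<Longrightarrow> 0 < q i * \<sigma>"
    and orth: "((\<Sum>i<m. p i) - a) * (\<Sum>i<m. q i) = (\<Sum>i<m. p i * q i)"
    and ab: "(real m - 1) * b\<^sup>2 \<le> a\<^sup>2"
  shows "((\<Sum>i<m. p i) - a)\<^sup>2 + b\<^sup>2 - (\<Sum>i<m. (p i)\<^sup>2) < (\<Sum>i<m. q i)\<^sup>2 - (\<Sum>i<m. (q i)\<^sup>2)"
proof -
  define Q where "Q = (\<Sum>i<m. q i)"
  define P where "P = (\<Sum>i<m. p i)"
  have Qs: "Q * \<sigma> > 0"
    unfolding Q_def sum_distrib_right using q m by (intro sum_pos) (auto simp: lessThan_empty_iff)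
  then have Q0: "Q \<noteq> 0" and s0: "\<sigma> \<noteq> 0" by auto
  \<comment> \<open>In terms of the weights \<open>w = q / \<Sum> q\<close> orthogonality says that \<open>\<Sum> p - a\<close> is the weighted mean \<open>M\<close>.\<close>
  define w where "w i = q i / Q" for i
  have wpos: "w i > 0" if "i < m" for i
  proof -
    have "w i = (q i * \<sigma>) / (Q * \<sigma>)"
      using s0 by (simp add: w_def)
    then show ?thesis using q[OF that] Qs by (metis divide_pos_pos)
  qed
  have w1: "(\<Sum>i<m. w i) = 1"
    unfolding w_def sum_divide_distrib[symmetric] using Q0 by (simp add: Q_def[symmetric])
  have wlt: "w i < 1" if "i < m" for i
  proof -
    obtain j where j: "j < m" "j \<noteq> i"
      using m that by (metis One_nat_def Suc_1 Suc_le_lessD less_2_cases_iff less_Suc0 not_less_eq order_less_trans zero_neq_one)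
    have "w i < w i + w j" using wpos[OF j(1)] by simp
    also have "\<dots> = (\<Sum>k\<in>{i,j}. w k)" using j by simp
    also have "\<dots> \<le> (\<Sum>k<m. w k)"
      using that j wpos by (intro sum_mono2) (auto intro: less_imp_le)
    finally show ?thesis using w1 by simp
  qed
  have w2: "(\<Sum>i<m. (w i)\<^sup>2) < 1"
  proof -
    have "(\<Sum>i<m. (w i)\<^sup>2) < (\<Sum>i<m. w i)"
    proof (rule sum_strict_mono)
      fix i assume "i \<in> {..<m}"
      then show "(w i)\<^sup>2 < w i"
        using wpos wlt by (simp add: power2_eq_square)
    qed (use m in \<open>auto simp: lessThan_empty_iff\<close>)
    then show ?thesis using w1 by simp
  qed
  have strict: "(\<Sum>i<m. (q i)\<^sup>2) < Q\<^sup>2"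
  proof -
    have "(\<Sum>i<m. (q i)\<^sup>2) = Q\<^sup>2 * (\<Sum>i<m. (w i)\<^sup>2)"
      unfolding sum_distrib_left w_def using Q0 by (simp add: power_divide)
    also have "\<dots> < Q\<^sup>2 * 1"
      using w2 Q0 by (intro mult_strict_left_mono) auto
    finally show ?thesis by simp
  qed
  define M where "M = (\<Sum>i<m. w i * p i)"
  have M: "M = P - a"
  proof -
    have "M * Q = (\<Sum>i<m. p i * q i)"
      unfolding M_def w_def sum_distrib_right using Q0 by (intro sum.cong) auto
    then have "M * Q = (P - a) * Q"
      using orth by (simp add: P_def Q_def)
    then show ?thesis using Q0 by simp
  qed
  \<comment> \<open>The form \<open>\<Sum> p\<^sup>2 - M\<^sup>2\<close> is nonnegative; evaluating it at \<open>p - \<tau>\<close> and choosing the optimal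
    \<open>\<tau>\<close> gives the lower bound \<open>a\<^sup>2 / (m - 1)\<close>.\<close>
  define \<tau> where "\<tau> = a / (real m - 1)"
  have "(\<Sum>i<m. w i * (p i - \<tau>)) = M - \<tau>"
    by (simp add: M_def algebra_simps sum_subtractf sum_distrib_left[symmetric] w1)
  then have "(M - \<tau>)\<^sup>2 \<le> (\<Sum>i<m. (w i)\<^sup>2) * (\<Sum>i<m. (p i - \<tau>)\<^sup>2)"
    using Cauchy_Schwarz_ineq_sum[of w "\<lambda>i. p i - \<tau>" "{..<m}"] by simp
  also have "\<dots> \<le> 1 * (\<Sum>i<m. (p i - \<tau>)\<^sup>2)"
    using w2 by (intro mult_right_mono sum_nonneg) auto
  also have "\<dots> = (\<Sum>i<m. (p i)\<^sup>2) - 2 * \<tau> * P + real m * \<tau>\<^sup>2"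
    by (simp add: power2_diff sum.distrib sum_subtractf sum_distrib_left[symmetric] P_def
        sum_distrib_right[symmetric] mult_ac)
  finally have "M\<^sup>2 + 2 * \<tau> * (P - M) - (real m - 1) * \<tau>\<^sup>2 \<le> (\<Sum>i<m. (p i)\<^sup>2)"
    by (simp add: power2_diff algebra_simps)
  moreover have "2 * \<tau> * (P - M) - (real m - 1) * \<tau>\<^sup>2 = a\<^sup>2 / (real m - 1)"
  proof -
    have "(real m - 1) * \<tau> = a"
      using m by (simp add: \<tau>_def)
    moreover have "a\<^sup>2 / (real m - 1) = \<tau> * a"
      by (simp add: \<tau>_def power2_eq_square)
    ultimately show ?thesis
      unfolding M by (simp add: power2_eq_square)
  qed
  moreover have "b\<^sup>2 \<le> a\<^sup>2 / (real m - 1)"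
    using ab m by (simp add: field_simps)
  ultimately have "M\<^sup>2 + b\<^sup>2 \<le> (\<Sum>i<m. (p i)\<^sup>2)"
    by linarith
  then show ?thesis
    using strict unfolding M P_def[symmetric] Q_def[symmetric] by linarith
qed

text \<open>In terms of \<open>u\<^sub>i = 1 / (z - r\<^sub>i)\<close> a zero \<open>z\<close> of the new polynomial satisfies
  \<open>(\<Sum> u\<^sub>i - a)\<^sup>2 + b\<^sup>2 = \<Sum> u\<^sub>i\<^sup>2\<close>. For nonreal \<open>z\<close> all \<open>u\<^sub>i\<close> lie on the same side of the real axis; the
  imaginary part of the equation is an orthogonality relation between their real and imaginary parts,
  and then the real part contradicts \<open>lorentzian_inequality\<close>. Degrees below \<open>2\<close>, where the form is not
  positive at any \<open>(q, 0)\<close>, are excluded by \<open>b \<noteq> 0\<close>.\<close>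

lemma real_rooted_quadratic_operator:
  assumes "real_rooted g" "g \<noteq> 0" "degree g \<le> d" "b \<noteq> 0" "(real d - 1) * b\<^sup>2 \<le> a\<^sup>2"
  shows "real_rooted (pderiv (pderiv g) - smult (of_real (2 * a)) (pderiv g)
            + smult (of_real (a\<^sup>2 + b\<^sup>2)) g)"
    (is "real_rooted ?h")
  unfolding real_rooted_def
proof (intro allI impI, rule ccontr)
  fix z assume z: "poly ?h z = 0" "z \<notin> \<real>"
  obtain r where r: "g = smult (lead_coeff g) (\<Prod>i<degree g. [:- r i, 1:])"
    "\<And>i. i < degree g \<Longrightarrow> poly g (r i) = 0"
    using root_factorization[OF assms(2)] by blast
  define m where "m = degree g"
  have rr: "Im (r i) = 0" if "i < m" for i
    using r(2)[of i] that assms(1) by (auto simp: real_rooted_def complex_is_Real_iff m_def)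
  have Imz: "Im z \<noteq> 0" using z(2) by (simp add: complex_is_Real_iff)
  have zr: "z \<noteq> r i" if "i < m" for i
    using rr[OF that] Imz by auto
  have gz: "poly g z \<noteq> 0"
    using assms(1) z(2) by (auto simp: real_rooted_def)
  define u where "u i = 1 / (z - r i)" for i
  define S where "S = (\<Sum>i<m. u i)"
  define T where "T = (\<Sum>i<m. (u i)\<^sup>2)"
  have d1: "poly (pderiv g) z = poly g z * S"
    using root_product_log_derivatives(1)[of m z r] zr unfolding S_def u_def m_def
    by (subst (1 2) r(1)) (simp add: pderiv_smult)
  have d2: "poly (pderiv (pderiv g)) z = poly g z * (S\<^sup>2 - T)"
    using root_product_log_derivatives(2)[of m z r] zr unfolding S_def T_def u_def m_def
    by (subst (1 2) r(1)) (simp add: pderiv_smult)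
  have "poly g z * (S\<^sup>2 - T - of_real (2 * a) * S + of_real (a\<^sup>2 + b\<^sup>2)) = 0"
    using z(1) d1 d2 by (simp add: algebra_simps)
  then have "S\<^sup>2 - T - of_real (2 * a) * S + of_real (a\<^sup>2 + b\<^sup>2) = 0"
    using gz by simp
  then have eq: "(S - of_real a)\<^sup>2 + of_real (b\<^sup>2) = T"
    by (simp add: power2_eq_square algebra_simps)
  define p where "p i = Re (u i)" for i
  define q where "q i = Im (u i)" for i
  have ReS: "Re S = (\<Sum>i<m. p i)" and ImS: "Im S = (\<Sum>i<m. q i)"
    by (simp_all add: S_def p_def q_def)
  have ReT: "Re T = (\<Sum>i<m. (p i)\<^sup>2) - (\<Sum>i<m. (q i)\<^sup>2)"
    and ImT: "Im T = 2 * (\<Sum>i<m. p i * q i)"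
    by (simp_all add: T_def p_def q_def power2_eq_square sum_subtractf sum_distrib_left mult_ac)
  have E1: "((\<Sum>i<m. p i) - a)\<^sup>2 - (\<Sum>i<m. q i)\<^sup>2 + b\<^sup>2 = (\<Sum>i<m. (p i)\<^sup>2) - (\<Sum>i<m. (q i)\<^sup>2)"
    using arg_cong[OF eq, of Re] by (simp add: ReS ImS ReT Re_power2)
  have E2: "((\<Sum>i<m. p i) - a) * (\<Sum>i<m. q i) = (\<Sum>i<m. p i * q i)"
    using arg_cong[OF eq, of Im] unfolding Im_power2 plus_complex.sel ImT
    by (simp add: ReS ImS del: sum_subtractf) (simp add: algebra_simps)
  have qs: "q i * (- Im z) > 0" if "i < m" for i
  proof -
    have "q i = - Im z / (cmod (z - r i))\<^sup>2"
      using rr[OF that] by (simp add: q_def u_def Im_divide cmod_power2)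
    then have "q i * (- Im z) = (Im z)\<^sup>2 / (cmod (z - r i))\<^sup>2"
      by (simp add: power2_eq_square)
    then show ?thesis using Imz zr[OF that] by simp
  qed
  consider "m = 0" | "m = 1" | "2 \<le> m" by linarith
  then show False
  proof cases
    case 1
    then show False using E1 assms(4) by (auto simp: sum_power2_eq_zero_iff)
  next
    case 2
    have "q 0 \<noteq> 0" using qs[of 0] 2 by auto
    with E2 2 have "a = 0" by simp
    with E1 2 assms(4) show False by simp
  next
    case 3
    have "(real m - 1) * b\<^sup>2 \<le> (real d - 1) * b\<^sup>2"
      using assms(3) by (intro mult_right_mono) (auto simp: m_def)
    then have "(real m - 1) * b\<^sup>2 \<le> a\<^sup>2" using assms(5) by linarith
    from lorentzian_inequality[OF 3 qs E2 this] E1 show False by linarith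
  qed
qed

definition diffop :: "complex poly \<Rightarrow> complex poly \<Rightarrow> complex poly" where
  "diffop q g = (\<Sum>k\<le>degree q. smult (coeff q k) ((pderiv ^^ k) g))"

lemma diffop_altdef:
  assumes "degree q \<le> N"
  shows "diffop q g = (\<Sum>k\<le>N. smult (coeff q k) ((pderiv ^^ k) g))"
  unfolding diffop_def using assms by (intro sum.mono_neutral_left) (auto simp: coeff_eq_0)

lemma diffop_pCons: "diffop (pCons c q) g = smult c g + pderiv (diffop q g)"
proof -
  have "diffop (pCons c q) g = (\<Sum>k\<le>Suc (degree q). smult (coeff (pCons c q) k) ((pderiv ^^ k) g))"
    by (rule diffop_altdef) (rule degree_pCons_le)
  also have "\<dots> = smult c g + (\<Sum>k\<le>degree q. smult (coeff q k) (pderiv ((pderiv ^^ k) g)))"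
    by (simp add: sum.atMost_Suc_shift del: sum.atMost_Suc)
  also have "(\<Sum>k\<le>degree q. smult (coeff q k) (pderiv ((pderiv ^^ k) g))) = pderiv (diffop q g)"
    unfolding diffop_def by (simp add: higher_pderiv_sum[of 1, simplified] pderiv_smult)
  finally show ?thesis .
qed

lemma diffop_add: "diffop (p + q) g = diffop p g + diffop q g"
proof -
  define N where "N = max (degree p) (degree q)"
  have "degree p \<le> N" "degree q \<le> N" "degree (p + q) \<le> N"
    by (simp_all add: N_def degree_add_le)
  then show ?thesis
    by (simp add: diffop_altdef smult_add_left sum.distrib)
qed

lemma diffop_smult: "diffop (smult c q) g = smult c (diffop q g)"
proof -
  have "smult c (\<Sum>k\<le>N. f k) = (\<Sum>k\<le>N. smult c (f k))" for N and f :: "nat \<Rightarrow> complex poly"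
    by (induction N) (simp_all add: smult_add_right)
  then show ?thesis
    using diffop_altdef[of "smult c q" "degree q" g] by (simp add: degree_smult_le diffop_def)
qed

lemma diffop_0: "diffop 0 g = 0"
  by (simp add: diffop_def)

lemma diffop_linear_mult:
  "diffop ([:- of_real a, 1:] * q) g = pderiv (diffop q g) - smult (of_real a) (diffop q g)"
  unfolding mult_pCons_left mult_zero_left
  by (simp only: diffop_add diffop_smult diffop_pCons diffop_0) simp

lemma diffop_conj_quadratic_mult:
  "diffop (conj_quadratic w * q) g =
     pderiv (pderiv (diffop q g)) - smult (of_real (2 * Re w)) (pderiv (diffop q g))
       + smult (of_real ((Re w)\<^sup>2 + (Im w)\<^sup>2)) (diffop q g)"
  unfolding conj_quadratic_def mult_pCons_left mult_zero_left
  by (simp only: diffop_add diffop_smult diffop_pCons diffop_0 pderiv_add pderiv_smult)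
    (simp add: pderiv_minus pderiv_smult)

lemma degree_diffop_le: "degree (diffop q g) \<le> degree g"
  unfolding diffop_def
proof (rule degree_sum_le)
  show "degree (smult (coeff q k) ((pderiv ^^ k) g)) \<le> degree g" for k
    using degree_smult_le[of "coeff q k" "(pderiv ^^ k) g"] by (simp add: degree_higher_pderiv)
qed simp

text \<open>The operator \<open>q(D)\<close> is the composition of the operators that belong to the real zeros and to the
  conjugate pairs of zeros of \<open>q\<close>. None of them raises the degree, so the same \<open>d\<close> serves for
  every factor.\<close>

lemma real_rooted_diffop:
  assumes "real_coeffs q" "real_rooted g" "degree g \<le> d"
    and "\<And>z. poly q z = 0 \<Longrightarrow> Im z \<noteq> 0 \<Longrightarrow> (real d - 1) * (Im z)\<^sup>2 \<le> (Re z)\<^sup>2"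
  shows "diffop q g = 0 \<or> real_rooted (diffop q g)"
  using assms(1,4)
proof (induction "degree q" arbitrary: q rule: less_induct)
  case less
  show ?case
  proof (cases "degree q = 0")
    case True
    then obtain c where "q = [:c:]" by (rule degree_eq_zeroE)
    then show ?thesis
      using assms(2) by (auto simp: diffop_pCons diffop_0 real_rooted_def)
  next
    case False
    then obtain w where w: "poly q w = 0"
      using fundamental_theorem_of_algebra[of q] by (auto simp: constant_degree)
    have q0: "q \<noteq> 0" using False by auto
    show ?thesis
    proof (cases "Im w = 0")
      case True
      obtain r where r: "q = [:- of_real (Re w), 1:] * r" "real_coeffs r"
        using real_coeffs_real_root[OF less.prems(1) w True] by blast
      have "degree r < degree q"
        using q0 by (subst r(1), subst degree_mult_eq) (auto simp: r(1))
      then have "diffop r g = 0 \<or> real_rooted (diffop r g)"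
        using less.hyps[of r] r less.prems(2) by auto
      then show ?thesis
        using real_rooted_linear_operator[of "diffop r g" "Re w"]
        unfolding r(1) diffop_linear_mult by auto
    next
      case False
      obtain r where r: "q = conj_quadratic w * r" "real_coeffs r"
        using real_coeffs_nonreal_root[OF less.prems(1) w False] by blast
      have "degree r < degree q"
        using q0 unfolding r(1) by (subst degree_mult_eq) (auto simp: degree_conj_quadratic)
      then have IH: "diffop r g = 0 \<or> real_rooted (diffop r g)"
        using less.hyps[of r] r less.prems(2) by auto
      have "degree (diffop r g) \<le> d"
        using degree_diffop_le[of r g] assms(3) by linarith
      then show ?thesis
        using IH real_rooted_quadratic_operator[of "diffop r g" d "Im w" "Re w"] False
          less.prems(2)[OF w False]
        unfolding r(1) diffop_conj_quadratic_mult by (cases "diffop r g = 0") auto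
    qed
  qed
qed

section \<open>Jensen polynomials as limits of real-rooted polynomials\<close>

text \<open>The Jensen polynomial with the order of its coefficients reversed: a member of the Appell sequence of
  \<open>\<gamma>\<close>.\<close>

definition appell_poly :: "(nat \<Rightarrow> complex) \<Rightarrow> nat \<Rightarrow> complex poly" where
  "appell_poly \<gamma> d = (\<Sum>k\<le>d. monom (of_nat (d choose k) * \<gamma> k) (d - k))"

lemma deriv_poly: "(deriv ^^ k) (poly p) = poly ((pderiv ^^ k) (p :: complex poly))"
proof (induction k)
  case (Suc k)
  show ?case
    by (rule ext) (simp add: Suc DERIV_imp_deriv[OF poly_DERIV])
qed simp

lemma higher_pderiv_at_0: "poly ((pderiv ^^ k) p) 0 = fact k * coeff (p :: complex poly) k"
  by (simp add: poly_0_coeff_0 coeff_higher_pderiv pochhammer_fact[symmetric])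

lemma higher_pderiv_power:
  "(pderiv ^^ k) (monom (1 :: complex) d) = monom (of_nat (d choose k) * fact k) (d - k)"
proof (induction k)
  case (Suc k)
  have "(d - k) * (d choose k) = Suc k * (d choose Suc k)"
    using binomial_absorb_comp[of d k] binomial_absorption[of k d] by simp
  then have "of_nat (d - k) * of_nat (d choose k) = (of_nat (Suc k) * of_nat (d choose Suc k) :: complex)"
    by (simp only: of_nat_mult[symmetric])
  then have "of_nat (d - k) * (of_nat (d choose k) * fact k) = (of_nat (d choose Suc k) * fact (Suc k) :: complex)"
    by (simp only: fact_Suc of_nat_mult mult_ac)
  then show ?case
    by (simp add: Suc pderiv_monom del: fact_Suc)
qed simp

lemma diffop_monom_eq_appell_poly:
  "diffop q (monom 1 d) = appell_poly (\<lambda>k. (deriv ^^ k) (poly q) 0) d"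
proof -
  define N where "N = max d (degree q)"
  have "diffop q (monom 1 d) = (\<Sum>k\<le>N. monom (of_nat (d choose k) * (fact k * coeff q k)) (d - k))"
    unfolding diffop_altdef[of q N, unfolded N_def, simplified, folded N_def]
    by (simp add: higher_pderiv_power smult_monom mult_ac)
  also have "\<dots> = (\<Sum>k\<le>d. monom (of_nat (d choose k) * (fact k * coeff q k)) (d - k))"
    by (intro sum.mono_neutral_right) (auto simp: N_def binomial_eq_0)
  finally show ?thesis
    by (simp add: appell_poly_def deriv_poly higher_pderiv_at_0)
qed

lemma jensen_poly_eq_appell_poly:
  assumes "z \<noteq> 0"
  shows "poly (jensen_poly g d) z = z ^ d * poly (appell_poly (\<lambda>k. (deriv ^^ k) g 0) d) (1 / z)"
proof -
  have "z ^ d * (1 / z) ^ (d - k) = z ^ k" if "k \<le> d" for k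
    using assms that by (simp add: field_simps power_add[symmetric])
  then show ?thesis
    unfolding jensen_poly_def appell_poly_def poly_sum poly_monom sum_distrib_left
    by (intro sum.cong) (auto simp: mult_ac)
qed

lemma coeff_appell_poly: "k \<le> d \<Longrightarrow> coeff (appell_poly \<gamma> d) (d - k) = of_nat (d choose k) * \<gamma> k"
proof -
  assume k: "k \<le> d"
  have "coeff (appell_poly \<gamma> d) (d - k) =
      (\<Sum>j\<le>d. if j = k then of_nat (d choose j) * \<gamma> j else 0)"
    unfolding appell_poly_def coeff_sum using k by (intro sum.cong) auto
  then show ?thesis using k by simp
qed

text \<open>For a nonzero polynomial this is equivalent to having only real zeros. The zero polynomial has the
  property as well, so that it is preserved by pointwise limits.\<close>

definition vertically_monotone :: "complex poly \<Rightarrow> bool" where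
  "vertically_monotone p \<longleftrightarrow>
     (\<forall>x y t. \<bar>t\<bar> \<le> \<bar>y\<bar> \<longrightarrow> cmod (poly p (Complex x t)) \<le> cmod (poly p (Complex x y)))"

lemma real_rooted_imp_vertically_monotone:
  assumes "p = 0 \<or> real_rooted p"
  shows "vertically_monotone p"
proof (cases "p = 0")
  case True
  then show ?thesis by (simp add: vertically_monotone_def)
next
  case False
  obtain r where r: "p = smult (lead_coeff p) (\<Prod>i<degree p. [:- r i, 1:])"
    "\<And>i. i < degree p \<Longrightarrow> poly p (r i) = 0"
    using root_factorization[OF False] by blast
  show ?thesis
    unfolding vertically_monotone_def
  proof (intro allI impI)
    fix x y t :: real assume "\<bar>t\<bar> \<le> \<bar>y\<bar>"
    then have ty: "t\<^sup>2 \<le> y\<^sup>2" by (rule abs_le_square_iff[THEN iffD1])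
    have fac: "cmod (Complex x t - r i) \<le> cmod (Complex x y - r i)" if "i < degree p" for i
    proof -
      have "Im (r i) = 0"
        using r(2)[OF that] False assms by (auto simp: real_rooted_def complex_is_Real_iff)
      then show ?thesis
        using ty by (simp add: cmod_def)
    qed
    have val: "cmod (poly p z) = cmod (lead_coeff p) * (\<Prod>i<degree p. cmod (z - r i))" for z
      by (subst r(1)) (simp add: norm_mult poly_prod prod_norm[symmetric])
    show "cmod (poly p (Complex x t)) \<le> cmod (poly p (Complex x y))"
      unfolding val using fac by (intro mult_left_mono prod_mono) auto
  qed
qed

text \<open>A nonreal zero would force a whole vertical segment of zeros below it.\<close>

lemma vertically_monotone_imp_real_rooted:
  assumes "vertically_monotone p" "p \<noteq> 0"
  shows "real_rooted p"
  unfolding real_rooted_def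
proof (intro allI impI, rule ccontr)
  fix z assume z: "poly p z = 0" "z \<notin> \<real>"
  have "poly p (Complex (Re z) t) = 0" if "\<bar>t\<bar> \<le> \<bar>Im z\<bar>" for t
    using assms(1) that z(1) unfolding vertically_monotone_def by (metis complex.collapse norm_le_zero_iff norm_zero)
  then have "Complex (Re z) ` {0..\<bar>Im z\<bar>} \<subseteq> {w. poly p w = 0}"
    by auto
  moreover have "finite {w. poly p w = 0}"
    using assms(2) by (rule poly_roots_finite)
  ultimately have "finite (Complex (Re z) ` {0..\<bar>Im z\<bar>})"
    by (rule finite_subset)
  moreover have "inj_on (Complex (Re z)) {0..\<bar>Im z\<bar>}"
    by (auto simp: inj_on_def)
  ultimately have "finite {0..\<bar>Im z\<bar>}"
    by (rule finite_imageD)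
  then show False
    using z(2) by (simp add: complex_is_Real_iff infinite_Icc)
qed

lemma hyperbolic_jensen_poly_limit:
  fixes \<gamma> :: "nat \<Rightarrow> nat \<Rightarrow> complex"
  assumes "\<And>j. vertically_monotone (appell_poly (\<gamma> j) d)"
    and "\<And>k. k \<le> d \<Longrightarrow> (\<lambda>j. \<gamma> j k) \<longlonglongrightarrow> (deriv ^^ k) g 0"
    and real: "\<And>k. (deriv ^^ k) g 0 \<in> \<real>"
  shows "hyperbolic (jensen_poly g d)"
proof -
  define A where "A = appell_poly (\<lambda>k. (deriv ^^ k) g 0) d"
  have lim: "(\<lambda>j. cmod (poly (appell_poly (\<gamma> j) d) z)) \<longlonglongrightarrow> cmod (poly A z)" for z
    unfolding A_def appell_poly_def poly_sum poly_monom
    by (intro tendsto_intros assms(2)) auto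
  have vm: "vertically_monotone A"
    unfolding vertically_monotone_def
  proof (intro allI impI)
    fix x y t :: real assume ty: "\<bar>t\<bar> \<le> \<bar>y\<bar>"
    show "cmod (poly A (Complex x t)) \<le> cmod (poly A (Complex x y))"
      using assms(1) ty
      by (intro LIMSEQ_le[OF lim lim]) (auto simp: vertically_monotone_def)
  qed
  have realJ: "coeff (jensen_poly g d) i \<in> \<real>" for i
    unfolding jensen_poly_def coeff_sum
    by (intro sum_in_Reals) (auto intro!: Reals_mult real)
  show ?thesis
  proof (cases "A = 0")
    case True
    have "(deriv ^^ k) g 0 = 0" if "k \<le> d" for k
      using coeff_appell_poly[OF that, of "\<lambda>k. (deriv ^^ k) g 0"] True that by (simp add: A_def)
    then have "jensen_poly g d = 0"
      by (simp add: jensen_poly_def)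
    then show ?thesis by (simp add: hyperbolic_def)
  next
    case False
    then have rr: "real_rooted A"
      using vm by (rule vertically_monotone_imp_real_rooted[rotated])
    have "z \<in> \<real>" if "poly (jensen_poly g d) z = 0" for z
    proof (cases "z = 0")
      case False
      with that have "poly A (1 / z) = 0"
        by (simp add: jensen_poly_eq_appell_poly A_def)
      then have "1 / z \<in> \<real>" using rr by (simp add: real_rooted_def)
      then have "inverse (1 / z) \<in> \<real>" by (rule Reals_inverse)
      then show ?thesis by simp
    qed simp
    then show ?thesis
      using realJ by (auto simp: hyperbolic_def)
  qed
qed

section \<open>Chains of nonreal zeros of successive derivatives\<close>

text \<open>Jensen's theorem. Outside the closed disc with diameter \<open>[r, cnj r]\<close> the sum
  \<open>1 / (z - r) + 1 / (z - cnj r)\<close> has a negative imaginary part in the upper half-plane. As \<open>p\<close> is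
  real, its zeros may be listed as \<open>r\<^sub>i\<close> or as \<open>cnj r\<^sub>i\<close>, and adding the two resulting expressions for
  \<open>p'/p\<close> pairs conjugates without any need to match them up in the list.\<close>

lemma jensen_zero_of_derivative:
  assumes p: "real_coeffs p" "pderiv p \<noteq> 0" and z: "poly (pderiv p) z = 0" "Im z > 0"
  obtains w where "poly p w = 0" "Im w > 0" "cmod (z - of_real (Re w)) \<le> Im w"
proof (rule ccontr)
  note found = that
  assume none: "\<not> thesis"
  have no: "cmod (z - of_real (Re w)) > Im w" if "poly p w = 0" "Im w > 0" for w
    using found[OF that] none by linarith
  have p0: "p \<noteq> 0" using p(2) by auto
  have deg: "degree p \<noteq> 0" using p(2) by (simp add: pderiv_eq_0_iff)
  have no': "cmod (z - of_real (Re w)) > \<bar>Im w\<bar>" if "poly p w = 0" for w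
  proof -
    consider "Im w > 0" | "Im w < 0" | "Im w = 0" by linarith
    then show ?thesis
    proof cases
      case 1
      then show ?thesis using no[OF that] by simp
    next
      case 2
      then show ?thesis
        using no[of "cnj w"] that p(1) by (simp add: poly_cnj_real_coeffs)
    next
      case 3
      have "0 < Im z" by (rule z)
      also have "\<dots> \<le> cmod (z - of_real (Re w))"
        using abs_Im_le_cmod[of "z - of_real (Re w)"] by simp
      finally show ?thesis using 3 by simp
    qed
  qed
  obtain r where r: "p = smult (lead_coeff p) (\<Prod>i<degree p. [:- r i, 1:])"
    "\<And>i. i < degree p \<Longrightarrow> poly p (r i) = 0"
    using root_factorization[OF p0] by blast
  define m where "m = degree p"
  have out: "(Im (r i))\<^sup>2 < (Re z - Re (r i))\<^sup>2 + (Im z)\<^sup>2" if "i < m" for i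
  proof -
    have "\<bar>Im (r i)\<bar>\<^sup>2 < (cmod (z - of_real (Re (r i))))\<^sup>2"
      using no'[OF r(2)] that by (intro power_strict_mono) (auto simp: m_def)
    then show ?thesis by (simp add: cmod_power2)
  qed
  have zr: "z \<noteq> r i" and zcr: "z \<noteq> cnj (r i)" if "i < m" for i
    using out[OF that] by auto
  have logd: "poly (pderiv p) z = poly p z * (\<Sum>i<m. 1 / (z - s i))"
    if "p = smult c (\<Prod>i<m. [:- s i, 1:])" "\<And>i. i < m \<Longrightarrow> z \<noteq> s i" for c s
    using root_product_log_derivatives(1)[of m z s] that(2)
    by (subst (1 2) that(1)) (simp add: pderiv_smult)
  have pz: "poly p z \<noteq> 0"
    using no'[of z] by (auto simp: cmod_def)
  have S1: "(\<Sum>i<m. 1 / (z - r i)) = 0"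
    using logd[OF r(1)[folded m_def] zr] z(1) pz by simp
  have cnjfac: "p = smult (cnj (lead_coeff p)) (\<Prod>i<m. [:- cnj (r i), 1:])"
  proof (rule poly_eq_poly_eq_iff[THEN iffD1], rule ext)
    fix x
    have "poly p x = cnj (poly p (cnj x))"
      using p(1) by (simp add: poly_cnj_real_coeffs)
    also have "\<dots> = poly (smult (cnj (lead_coeff p)) (\<Prod>i<m. [:- cnj (r i), 1:])) x"
      by (subst r(1)) (simp add: poly_prod m_def)
    finally show "poly p x = \<dots>" .
  qed
  have S2: "(\<Sum>i<m. 1 / (z - cnj (r i))) = 0"
    using logd[OF cnjfac zcr] z(1) pz by simp
  have neg: "Im (1 / (z - r i) + 1 / (z - cnj (r i))) < 0" if "i < m" for i
  proof -
    define x y b where "x = Re z - Re (r i)" and "y = Im z" and "b = Im (r i)"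
    define A B where "A = x\<^sup>2 + (y - b)\<^sup>2" and "B = x\<^sup>2 + (y + b)\<^sup>2"
    have "A \<noteq> 0" "B \<noteq> 0"
      using zr[OF that] zcr[OF that] unfolding A_def B_def x_def y_def b_def
      by (auto simp: complex_eq_iff sum_power2_eq_zero_iff)
    then have AB: "A > 0" "B > 0"
      by (auto simp: A_def B_def less_le)
    have "Im (1 / (z - r i) + 1 / (z - cnj (r i))) = - (y - b) / A - (y + b) / B"
      by (simp add: Im_divide A_def B_def x_def y_def b_def diff_divide_distrib add_divide_distrib)
    also have "\<dots> = - ((y - b) * B + (y + b) * A) / (A * B)"
      using AB by (simp add: field_simps)
    also have "(y - b) * B + (y + b) * A = 2 * y * (x\<^sup>2 + y\<^sup>2 - b\<^sup>2)"
      unfolding A_def B_def by (simp add: power2_eq_square algebra_simps)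
    also have "- (2 * y * (x\<^sup>2 + y\<^sup>2 - b\<^sup>2)) / (A * B) < 0"
      using AB out[OF that] z(2) by (auto simp: x_def y_def b_def intro!: divide_neg_pos)
    finally show ?thesis .
  qed
  have "Im (\<Sum>i<m. 1 / (z - r i) + 1 / (z - cnj (r i))) < 0"
  proof -
    have "0 < (\<Sum>i<m. - Im (1 / (z - r i) + 1 / (z - cnj (r i))))"
    proof (rule sum_pos)
      show "{..<m} \<noteq> {}" using deg by (simp add: m_def lessThan_empty_iff)
      show "0 < - Im (1 / (z - r i) + 1 / (z - cnj (r i)))" if "i \<in> {..<m}" for i
        using neg[of i] that by simp
    qed simp
    then show ?thesis
      unfolding Im_sum sum_negf by simp
  qed
  moreover have "(\<Sum>i<m. 1 / (z - r i) + 1 / (z - cnj (r i))) = 0"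
    unfolding sum.distrib S1 S2 by simp
  ultimately show False by simp
qed

text \<open>By the second condition each \<open>z (Suc k)\<close> lies in the Jensen disc of \<open>z k\<close>, the closed disc with diameter
  \<open>[z k, cnj (z k)]\<close>.\<close>

definition zero_chain :: "complex poly \<Rightarrow> nat \<Rightarrow> (nat \<Rightarrow> complex) \<Rightarrow> bool" where
  "zero_chain p n z \<longleftrightarrow>
     (\<forall>k\<le>n. poly ((pderiv ^^ k) p) (z k) = 0 \<and> Im (z k) > 0) \<and>
     (\<forall>k<n. cmod (z (Suc k) - of_real (Re (z k))) \<le> Im (z k))"

lemma zero_chain_exists:
  assumes "real_coeffs p" "(pderiv ^^ n) p \<noteq> 0" "poly ((pderiv ^^ n) p) w = 0" "Im w > 0"
  obtains z where "zero_chain p n z" "z n = w"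
proof -
  have "\<exists>z. zero_chain p n z \<and> z n = w"
    using assms(2-)
  proof (induction n arbitrary: w)
    case 0
    then show ?case by (intro exI[of _ "\<lambda>_. w"]) (auto simp: zero_chain_def)
  next
    case (Suc n)
    obtain v where v: "poly ((pderiv ^^ n) p) v = 0" "Im v > 0" "cmod (w - of_real (Re v)) \<le> Im v"
      using jensen_zero_of_derivative[of "(pderiv ^^ n) p" w] Suc.prems
        real_coeffs_higher_pderiv[OF assms(1)] by auto
    have "(pderiv ^^ n) p \<noteq> 0"
      using Suc.prems(1) by auto
    from Suc.IH[OF this v(1,2)] obtain z where z: "zero_chain p n z" "z n = v" by blast
    let ?z = "z(Suc n := w)"
    have "zero_chain p (Suc n) ?z"
      using z v Suc.prems unfolding zero_chain_def by (auto simp: less_Suc_eq le_Suc_eq)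
    then show ?case
      by (intro exI[of _ ?z] conjI) (simp_all only: fun_upd_same)
  qed
  then show ?thesis using that by blast
qed

text \<open>If \<open>\<Delta>\<close> is the horizontal displacement, the Jensen disc gives \<open>\<Delta>\<^sup>2 \<le> y\<^sub>k\<^sup>2 - y\<^sub>k\<^sub>+\<^sub>1\<^sup>2\<close> for the heights; since
  the heights are positive and do not increase, the square of their difference obeys the same bound.\<close>

lemma zero_chain_step:
  assumes "zero_chain p n z" "k < n"
  shows "(cmod (z (Suc k) - z k))\<^sup>2 \<le> 2 * ((Im (z k))\<^sup>2 - (Im (z (Suc k)))\<^sup>2)"
proof -
  define a b where "a = Im (z k)" and "b = Im (z (Suc k))"
  define x where "x = Re (z (Suc k)) - Re (z k)"
  have pos: "a > 0" "b > 0"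
    using assms by (auto simp: zero_chain_def a_def b_def)
  have "cmod (z (Suc k) - of_real (Re (z k))) \<le> a"
    using assms by (auto simp: zero_chain_def a_def)
  then have "(cmod (z (Suc k) - of_real (Re (z k))))\<^sup>2 \<le> a\<^sup>2"
    by (intro power_mono) auto
  then have 1: "x\<^sup>2 + b\<^sup>2 \<le> a\<^sup>2"
    by (simp add: cmod_power2 x_def b_def)
  then have "b\<^sup>2 \<le> a\<^sup>2"
    using zero_le_power2[of x] by linarith
  then have "b \<le> a"
    using pos by (auto intro: power2_le_imp_le)
  then have "(b - a)\<^sup>2 \<le> a\<^sup>2 - b\<^sup>2"
    using pos mult_nonneg_nonneg[of b "a - b"] by (simp add: power2_eq_square algebra_simps)
  then have "x\<^sup>2 + (b - a)\<^sup>2 \<le> 2 * (a\<^sup>2 - b\<^sup>2)"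
    using 1 by simp
  then show ?thesis
    by (simp add: cmod_power2 x_def a_def b_def)
qed

text \<open>The bounds for the squared steps telescope, and the Cauchy-Schwarz inequality passes from squares
  to lengths.\<close>

lemma zero_chain_length:
  assumes "zero_chain p n z"
  shows "(\<Sum>k<n. cmod (z (Suc k) - z k)) \<le> sqrt (2 * real n) * Im (z 0)"
    and "Im (z n) \<le> Im (z 0)"
proof -
  have "(\<Sum>k<n. (cmod (z (Suc k) - z k))\<^sup>2) \<le> (\<Sum>k<n. 2 * ((Im (z k))\<^sup>2 - (Im (z (Suc k)))\<^sup>2))"
    using zero_chain_step[OF assms] by (intro sum_mono) auto
  also have "\<dots> = 2 * ((Im (z 0))\<^sup>2 - (Im (z n))\<^sup>2)"
    unfolding sum_distrib_left[symmetric] sum_lessThan_telescope'[of "\<lambda>k. (Im (z k))\<^sup>2"] ..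
  finally have sq: "(\<Sum>k<n. (cmod (z (Suc k) - z k))\<^sup>2) \<le> 2 * ((Im (z 0))\<^sup>2 - (Im (z n))\<^sup>2)" .
  have pos: "Im (z 0) > 0" "Im (z n) > 0"
    using assms by (auto simp: zero_chain_def)
  have "(\<Sum>k<n. cmod (z (Suc k) - z k))\<^sup>2 \<le> (\<Sum>k<n. (cmod (z (Suc k) - z k))\<^sup>2) * real n"
    using sum_squared_le_sum_of_squares[of "\<lambda>k. cmod (z (Suc k) - z k)" "{..<n}"] by simp
  also have "\<dots> \<le> (2 * ((Im (z 0))\<^sup>2 - (Im (z n))\<^sup>2)) * real n"
    using sq by (intro mult_right_mono) auto
  also have "\<dots> \<le> (2 * (Im (z 0))\<^sup>2) * real n"
    by (intro mult_right_mono) auto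
  also have "\<dots> = (sqrt (2 * real n) * Im (z 0))\<^sup>2"
    by (simp add: power_mult_distrib)
  finally have "(\<Sum>k<n. cmod (z (Suc k) - z k))\<^sup>2 \<le> (sqrt (2 * real n) * Im (z 0))\<^sup>2" .
  then show "(\<Sum>k<n. cmod (z (Suc k) - z k)) \<le> sqrt (2 * real n) * Im (z 0)"
    by (rule power2_le_imp_le) (use pos in simp)
  have "0 \<le> 2 * ((Im (z 0))\<^sup>2 - (Im (z n))\<^sup>2)"
    by (rule order_trans[OF sum_nonneg sq]) simp
  then have "(Im (z n))\<^sup>2 \<le> (Im (z 0))\<^sup>2" by simp
  then show "Im (z n) \<le> Im (z 0)"
    using pos by (auto intro: power2_le_imp_le)
qed

section \<open>Smallness of a polynomial whose derivatives vanish along a chain\<close>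

lemma poly_bound_from_derivative:
  fixes p :: "complex poly"
  assumes C: "convex C" "a \<in> C" "w \<in> C" and pa: "poly p a = 0" and L: "L \<ge> 0" and M: "M \<ge> 0"
    and bound: "\<And>v. v \<in> C \<Longrightarrow> cmod (poly (pderiv p) v) \<le> M * (cmod (v - a) + L) ^ n / fact n"
  shows "cmod (poly p w) \<le> M * (cmod (w - a) + L) ^ Suc n / fact (Suc n)"
proof -
  define R where "R = cmod (w - a)"
  define \<phi> where "\<phi> t = M * (t * R + L) ^ Suc n / fact (Suc n)" for t :: real
  define l where "l t = a + of_real t * (w - a)" for t :: real
  have inC: "l t \<in> C" if "0 \<le> t" "t \<le> 1" for t
  proof -
    have "l t = (1 - t) *\<^sub>R a + t *\<^sub>R w"
      by (simp add: l_def scaleR_conv_of_real algebra_simps)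
    then show ?thesis
      using C that convexD_alt[of C a w t] by simp
  qed
  have vd: "((\<lambda>t. poly p (l t)) has_vector_derivative (w - a) * poly (pderiv p) (l t)) (at t)" for t
  proof -
    have "(l has_vector_derivative (w - a)) (at t)"
      unfolding l_def by (auto intro!: derivative_eq_intros)
    then show ?thesis
      using field_vector_diff_chain_at[OF _ poly_DERIV, of l "w - a" t p] by (simp add: o_def)
  qed
  have \<phi>d: "(\<phi> has_vector_derivative (M * R * (t * R + L) ^ n / fact n)) (at t)" for t
  proof -
    have lin: "((\<lambda>t. t * R + L) has_real_derivative R) (at t)"
      by (auto intro!: derivative_eq_intros)
    have "((\<lambda>t. (t * R + L) ^ Suc n) has_real_derivative real (Suc n) * ((t * R + L) ^ n * R)) (at t)"
      using DERIV_power_Suc[OF lin, of n] by (simp add: mult_ac del: power_Suc)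
    then have "(\<phi> has_real_derivative (M * (real (Suc n) * ((t * R + L) ^ n * R)) / fact (Suc n))) (at t)"
      unfolding \<phi>_def by (intro DERIV_cdivide DERIV_cmult)
    also have "M * (real (Suc n) * ((t * R + L) ^ n * R)) / fact (Suc n) = M * R * (t * R + L) ^ n / fact n"
      by (simp add: field_simps del: of_nat_Suc)
    finally show ?thesis
      by (simp add: has_real_derivative_iff_has_vector_derivative)
  qed
  have "cmod (poly p (l 1) - poly p (l 0)) \<le> \<phi> 1 - \<phi> 0"
  proof (rule differentiable_bound_general[where f = "\<lambda>t. poly p (l t)"])
    show "continuous_on {0..1} (\<lambda>t. poly p (l t))"
      using vd by (intro continuous_at_imp_continuous_on) (auto intro: has_vector_derivative_continuous)
    show "continuous_on {0..1} \<phi>"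
      using \<phi>d by (intro continuous_at_imp_continuous_on) (auto intro: has_vector_derivative_continuous)
    fix t :: real assume t: "0 < t" "t < 1"
    show "((\<lambda>t. poly p (l t)) has_vector_derivative (w - a) * poly (pderiv p) (l t)) (at t)"
      by (rule vd)
    show "(\<phi> has_vector_derivative (M * R * (t * R + L) ^ n / fact n)) (at t)"
      by (rule \<phi>d)
    have "cmod (l t - a) = t * R"
      using t by (simp add: l_def R_def norm_mult)
    then have "cmod (poly (pderiv p) (l t)) \<le> M * (t * R + L) ^ n / fact n"
      using bound[OF inC[of t]] t by simp
    then have "R * cmod (poly (pderiv p) (l t)) \<le> R * (M * (t * R + L) ^ n / fact n)"
      by (intro mult_left_mono) (auto simp: R_def)
    then show "cmod ((w - a) * poly (pderiv p) (l t)) \<le> M * R * (t * R + L) ^ n / fact n"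
      by (simp add: norm_mult R_def mult_ac)
  qed simp
  moreover have "\<phi> 0 \<ge> 0"
    using L M by (simp add: \<phi>_def)
  ultimately show ?thesis
    by (simp add: l_def pa \<phi>_def R_def)
qed

text \<open>Integrating \<open>p\<^sup>(\<^sup>k\<^sup>+\<^sup>1\<^sup>)\<close> from the zero \<open>z\<^sub>k\<close> of \<open>p\<^sup>(\<^sup>k\<^sup>)\<close>, for \<open>k = n - 1, \<dots>, 0\<close>, recovers \<open>p\<close> from
  \<open>p\<^sup>(\<^sup>n\<^sup>)\<close>. The integrals of powers of the length travelled produce the factor \<open>1 / n!\<close>, which
  compensates the factorial in Cauchy's inequality.\<close>

lemma gontcharoff_bound:
  fixes p :: "complex poly"
  assumes "convex C" "\<And>k. k \<le> n \<Longrightarrow> z k \<in> C" "w \<in> C" "M \<ge> 0"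
    and "\<And>k. k < n \<Longrightarrow> poly ((pderiv ^^ k) p) (z k) = 0"
    and "\<And>v. v \<in> C \<Longrightarrow> cmod (poly ((pderiv ^^ n) p) v) \<le> M"
  shows "cmod (poly p w) \<le> M * (cmod (w - z 0) + (\<Sum>k<n. cmod (z (Suc k) - z k))) ^ n / fact n"
  using assms
proof (induction n arbitrary: p z w)
  case 0
  then show ?case by simp
next
  case (Suc n)
  define L where "L = (\<Sum>k<Suc n. cmod (z (Suc k) - z k))"
  show ?case
    unfolding L_def[symmetric]
  proof (rule poly_bound_from_derivative)
    show "convex C" "z 0 \<in> C" "w \<in> C" "0 \<le> M" "poly p (z 0) = 0"
      using Suc.prems(1-4) Suc.prems(5)[of 0] by auto
    show "0 \<le> L"
      unfolding L_def by (intro sum_nonneg) auto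
    fix v assume v: "v \<in> C"
    have "cmod (poly (pderiv p) v) \<le>
        M * (cmod (v - z 1) + (\<Sum>k<n. cmod (z (Suc (Suc k)) - z (Suc k)))) ^ n / fact n"
      using Suc.IH[of "\<lambda>k. z (Suc k)" v "pderiv p"] v Suc.prems(1,2,4) Suc.prems(5)[of "Suc _"] Suc.prems(6)
      by (simp add: funpow_swap1)
    also have "\<dots> \<le> M * (cmod (v - z 0) + L) ^ n / fact n"
    proof -
      have "cmod (v - z 1) \<le> cmod (v - z 0) + cmod (z 1 - z 0)"
        using norm_triangle_ineq4[of "v - z 0" "z 1 - z 0"] by simp
      moreover have "L = cmod (z 1 - z 0) + (\<Sum>k<n. cmod (z (Suc (Suc k)) - z (Suc k)))"
        unfolding L_def by (subst sum.lessThan_Suc_shift) simp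
      ultimately show ?thesis
        using \<open>0 \<le> M\<close>
        by (intro divide_right_mono mult_left_mono power_mono add_nonneg_nonneg sum_nonneg) auto
    qed
    finally show "cmod (poly (pderiv p) v) \<le> M * (cmod (v - z 0) + L) ^ n / fact n" .
  qed
qed

lemma higher_pderiv_bound:
  fixes p :: "complex poly"
  assumes "D > 0" "\<And>z. cmod z \<le> 10 * D \<Longrightarrow> cmod (poly p z) \<le> M" "cmod v \<le> D"
  shows "cmod (poly ((pderiv ^^ n) p) v) \<le> fact n * M / (9 * D) ^ n"
proof -
  have "cmod ((deriv ^^ n) (poly p) v) \<le> fact n * M / (9 * D) ^ n"
  proof (rule Cauchy_inequality)
    fix x assume "cmod (v - x) = 9 * D"
    then have "cmod x \<le> 10 * D"
      using norm_triangle_ineq2[of x v] assms(3) by (simp add: norm_minus_commute)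
    then show "cmod (poly p x) \<le> M" by (rule assms(2))
  qed (use assms(1) in \<open>auto intro!: holomorphic_intros continuous_intros\<close>)
  then show ?thesis by (simp add: deriv_poly)
qed

text \<open>The chain of zeros and the vanishing along it in one statement. The radius \<open>D\<close> bounds the chain, the
  point \<open>x\<close> and the length of the path from \<open>x\<close> to \<open>z\<^sub>0\<close> and on along the chain. In the latter the length of
  the chain counts twice, as \<open>z\<^sub>0\<close> is within that length of \<open>w\<close>; hence the factor \<open>2\<close>.
  Cauchy's inequality is applied on discs of radius \<open>9 D\<close> about points of \<open>cball 0 D\<close>, whence \<open>9\<close> and
  \<open>10\<close>.\<close>

lemma nonreal_zero_of_higher_derivative:
  assumes p: "real_coeffs p" "(pderiv ^^ n) p \<noteq> 0"
    and w: "poly ((pderiv ^^ n) p) w = 0" "Im w \<noteq> 0"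
  obtains w\<^sub>0 where "poly p w\<^sub>0 = 0" "Im w\<^sub>0 \<noteq> 0" "\<bar>Im w\<bar> \<le> \<bar>Im w\<^sub>0\<bar>"
    "cmod (w - w\<^sub>0) \<le> sqrt (2 * real n) * \<bar>Im w\<^sub>0\<bar>"
    "\<And>M x D. cmod x + cmod w + 2 * sqrt (2 * real n) * \<bar>Im w\<^sub>0\<bar> \<le> D \<Longrightarrow>
       (\<And>z. cmod z \<le> 10 * D \<Longrightarrow> cmod (poly p z) \<le> M) \<Longrightarrow> cmod (poly p x) \<le> M / 9 ^ n"
proof -
  define w' where "w' = (if Im w > 0 then w else cnj w)"
  have w': "poly ((pderiv ^^ n) p) w' = 0" "Im w' > 0" "cmod w' = cmod w" "Im w' = \<bar>Im w\<bar>"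
    using w poly_cnj_real_coeffs[OF real_coeffs_higher_pderiv[OF p(1)]]
    by (auto simp: w'_def)
  obtain z where z: "zero_chain p n z" "z n = w'"
    using zero_chain_exists[OF p w'(1,2)] by blast
  define L where "L = (\<Sum>k<n. cmod (z (Suc k) - z k))"
  have L: "L \<le> sqrt (2 * real n) * Im (z 0)"
    unfolding L_def by (rule zero_chain_length(1)[OF z(1)])
  have zpos: "Im (z 0) > 0" using z(1) by (auto simp: zero_chain_def)
  have dist: "cmod (z k - w') \<le> L" if "k \<le> n" for k
  proof -
    have "w' - z k = (\<Sum>i=k..<n. z (Suc i) - z i)"
      using sum_Suc_diff'[OF that, of z] z(2) by simp
    then have "cmod (z k - w') \<le> (\<Sum>i=k..<n. cmod (z (Suc i) - z i))"
      by (subst norm_minus_commute) (simp add: sum_norm_le)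
    also have "\<dots> \<le> L"
      unfolding L_def by (rule sum_mono2) auto
    finally show ?thesis .
  qed
  have big: "cmod (poly p x) \<le> M / 9 ^ n"
    if D: "cmod x + cmod w + 2 * sqrt (2 * real n) * Im (z 0) \<le> D"
      and M: "\<And>z. cmod z \<le> 10 * D \<Longrightarrow> cmod (poly p z) \<le> M" for x M D
  proof -
    have L0: "L \<ge> 0" unfolding L_def by (intro sum_nonneg) auto
    have wpos: "cmod w > 0" using w(2) by auto
    have DL: "cmod x + cmod w + 2 * L \<le> D" using D L by simp
    then have Dpos: "D > 0" using L0 wpos norm_ge_zero[of x] by linarith
    have M0: "M \<ge> 0"
      using order_trans[OF norm_ge_zero M[of 0]] Dpos by simp
    have zin: "cmod (z k) \<le> cmod w + L" if "k \<le> n" for k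
      using norm_triangle_ineq2[of "z k" w'] dist[OF that] w'(3) by simp
    have "cmod (poly p x) \<le> (fact n * M / (9 * D) ^ n) *
        (cmod (x - z 0) + (\<Sum>k<n. cmod (z (Suc k) - z k))) ^ n / fact n"
    proof (rule gontcharoff_bound[where C = "cball 0 D"])
      show "z k \<in> cball 0 D" if "k \<le> n" for k
        using zin[OF that] DL L0 norm_ge_zero[of x] unfolding mem_cball_0 by linarith
      show "x \<in> cball 0 D"
        using DL L0 wpos unfolding mem_cball_0 by linarith
      show "cmod (poly ((pderiv ^^ n) p) v) \<le> fact n * M / (9 * D) ^ n" if "v \<in> cball 0 D" for v
        using higher_pderiv_bound[OF Dpos M] that by simp
      show "poly ((pderiv ^^ k) p) (z k) = 0" if "k < n" for k
        using z(1) that by (auto simp: zero_chain_def)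
    qed (use M0 Dpos in auto)
    also have "\<dots> \<le> (fact n * M / (9 * D) ^ n) * D ^ n / fact n"
    proof -
      have "cmod (x - z 0) \<le> cmod x + (cmod w + L)"
        using norm_triangle_ineq4[of x "z 0"] zin[of 0] by simp
      then have "cmod (x - z 0) + L \<le> D" using DL by simp
      then show ?thesis
        unfolding L_def[symmetric] using M0 Dpos L0
        by (intro divide_right_mono mult_left_mono power_mono) auto
    qed
    also have "\<dots> = M / 9 ^ n"
      using Dpos by (simp add: power_mult_distrib)
    finally show ?thesis .
  qed
  define w0 where "w0 = (if Im w > 0 then z 0 else cnj (z 0))"
  have Imw0: "\<bar>Im w0\<bar> = Im (z 0)"
    using zpos by (auto simp: w0_def)
  show ?thesis
  proof (rule that[of w0])
    have "poly p (z 0) = 0"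
      using z(1) by (auto simp: zero_chain_def)
    then show "poly p w0 = 0"
      using p(1) by (auto simp: w0_def poly_cnj_real_coeffs)
    show "Im w0 \<noteq> 0" using Imw0 zpos by auto
    show "\<bar>Im w\<bar> \<le> \<bar>Im w0\<bar>"
      using zero_chain_length(2)[OF z(1)] z(2) w'(4) Imw0 by simp
    have "cmod (w - w0) = cmod (w' - z 0)"
      using complex_mod_cnj[of "w - cnj (z 0)"] by (auto simp: w0_def w'_def)
    also have "\<dots> \<le> L"
      using dist[of 0] by (simp add: norm_minus_commute)
    finally show "cmod (w - w0) \<le> sqrt (2 * real n) * \<bar>Im w0\<bar>"
      using L Imw0 by simp
    show "cmod (poly p x) \<le> M / 9 ^ n"
      if "cmod x + cmod w + 2 * sqrt (2 * real n) * \<bar>Im w0\<bar> \<le> D"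
        "\<And>z. cmod z \<le> 10 * D \<Longrightarrow> cmod (poly p z) \<le> M" for M x D
      using big that unfolding Imw0 by blast
  qed
qed

section \<open>Splitting off the zeros of an entire function in a disc\<close>

definition conj_symmetric :: "(complex \<Rightarrow> complex) \<Rightarrow> bool" where
  "conj_symmetric F \<longleftrightarrow> (\<forall>z. F (cnj z) = cnj (F z))"

lemma factor_out_zero:
  assumes "h holomorphic_on UNIV" "h \<alpha> = 0"
  obtains k where "k holomorphic_on UNIV" "\<And>z. h z = (z - \<alpha>) * k z"
proof
  let ?k = "\<lambda>z. if z = \<alpha> then deriv h \<alpha> else h z / (z - \<alpha>)"
  show "?k holomorphic_on UNIV"
    by (rule pole_theorem_open_0[where g = h and a = \<alpha>]) (use assms in auto)
  show "h z = (z - \<alpha>) * ?k z" for z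
    using assms(2) by auto
qed

text \<open>Away from the zeros of \<open>P\<close> the symmetry of \<open>h\<close> follows by division, and at these finitely many points by
  continuity.\<close>

lemma conj_symmetric_cofactor:
  assumes h: "h holomorphic_on UNIV" and P: "real_coeffs P" "P \<noteq> 0"
    and F: "conj_symmetric F" "\<And>z. F z = poly P z * h z"
  shows "conj_symmetric h"
proof -
  define u where "u z = h (cnj z) - cnj (h z)" for z
  have "continuous_on UNIV h"
    using h by (rule holomorphic_on_imp_continuous_on)
  then have "continuous_on UNIV u"
    unfolding u_def by (auto intro!: continuous_intros intro: continuous_on_compose2)
  then have "open {z. u z \<noteq> 0}"
    by (intro open_Collect_neq) auto
  moreover have "{z. u z \<noteq> 0} \<subseteq> cnj ` {z. poly P z = 0}"
  proof (intro subsetI, rule image_eqI)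
    fix z assume z: "z \<in> {z. u z \<noteq> 0}"
    have "poly P (cnj z) * h (cnj z) = poly P (cnj z) * cnj (h z)"
      using F P(1) by (metis complex_cnj_mult conj_symmetric_def poly_cnj_real_coeffs)
    then show "cnj z \<in> {z. poly P z = 0}"
      using z by (auto simp: u_def)
  qed simp
  moreover have "finite (cnj ` {z. poly P z = 0})"
    using poly_roots_finite[OF P(2)] by simp
  ultimately have "{z. u z \<noteq> 0} = {}"
    using finite_subset finite_imp_not_open by blast
  then show ?thesis
    by (auto simp: conj_symmetric_def u_def)
qed

definition root_split :: "(complex \<Rightarrow> complex) \<Rightarrow> real \<Rightarrow> complex poly \<Rightarrow> (complex \<Rightarrow> complex) \<Rightarrow> bool" where
  "root_split F R P h \<longleftrightarrow> real_coeffs P \<and> lead_coeff P = 1 \<and> h holomorphic_on UNIV \<and>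
     (\<forall>z. F z = poly P z * h z) \<and> (\<forall>z. poly P z = 0 \<longrightarrow> cmod z \<le> R)"

text \<open>On the circle of radius \<open>3 R\<close> each factor \<open>z - r\<^sub>i\<close> of \<open>P\<close> has modulus at least \<open>2 R\<close>, at the origin
  at most \<open>R\<close>. By the maximum principle the two bounds combine to
  \<open>|h z / h 0| \<le> 2\<^sup>-\<^sup>k M / |F 0|\<close>, \<open>k = degree P\<close>: every zero that is split off gains a factor \<open>2\<close>.\<close>

lemma root_split_bounds:
  assumes "root_split F R P h" "R > 0" "\<And>z. cmod z = 3 * R \<Longrightarrow> cmod (F z) \<le> M"
  shows "cmod z \<le> 3 * R \<Longrightarrow> cmod (h z) \<le> M / (2 * R) ^ degree P"
    and "cmod (F 0) \<le> R ^ degree P * cmod (h 0)"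
proof -
  have P: "lead_coeff P = 1" "h holomorphic_on UNIV" "\<And>z. F z = poly P z * h z"
    "\<And>z. poly P z = 0 \<Longrightarrow> cmod z \<le> R"
    using assms(1) by (auto simp: root_split_def)
  have "P \<noteq> 0" using P(1) by auto
  then obtain r where r: "P = smult (lead_coeff P) (\<Prod>i<degree P. [:- r i, 1:])"
    "\<And>i. i < degree P \<Longrightarrow> poly P (r i) = 0"
    using root_factorization by blast
  have val: "cmod (poly P z) = (\<Prod>i<degree P. cmod (z - r i))" for z
    by (subst r(1)) (simp add: P(1) norm_mult poly_prod prod_norm[symmetric])
  have rR: "cmod (r i) \<le> R" if "i < degree P" for i
    using P(4)[OF r(2)[OF that]] .
  have low: "(2 * R) ^ degree P \<le> cmod (poly P z)" if z: "cmod z = 3 * R" for z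
  proof -
    have "(\<Prod>i<degree P. 2 * R) \<le> (\<Prod>i<degree P. cmod (z - r i))"
    proof (rule prod_mono)
      fix i assume "i \<in> {..<degree P}"
      then show "0 \<le> 2 * R \<and> 2 * R \<le> cmod (z - r i)"
        using norm_triangle_ineq2[of z "r i"] rR[of i] z assms(2) by simp
    qed
    then show ?thesis by (simp add: val)
  qed
  show "cmod (h z) \<le> M / (2 * R) ^ degree P" if z: "cmod z \<le> 3 * R"
  proof (rule maximum_modulus_frontier[where f = h and \<xi> = z and S = "cball 0 (3 * R)"])
    show "h holomorphic_on interior (cball 0 (3 * R))" "continuous_on (closure (cball 0 (3 * R))) h"
      using P(2) by (auto intro: holomorphic_on_subset holomorphic_on_imp_continuous_on continuous_on_subset)
    show "z \<in> cball 0 (3 * R)" using z by simp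
    fix x :: complex assume "x \<in> frontier (cball 0 (3 * R))"
    then have x: "cmod x = 3 * R" using assms(2) by (simp add: frontier_cball)
    have "(2 * R) ^ degree P * cmod (h x) \<le> cmod (poly P x) * cmod (h x)"
      using low[OF x] by (intro mult_right_mono) auto
    also have "\<dots> \<le> M"
      using assms(3)[OF x] P(3)[of x] by (simp add: norm_mult)
    finally show "cmod (h x) \<le> M / (2 * R) ^ degree P"
      using assms(2) by (simp add: field_simps)
  qed simp
  have "cmod (poly P 0) \<le> R ^ degree P"
    using prod_mono[of "{..<degree P}" "\<lambda>i. cmod (0 - r i)" "\<lambda>_. R"] rR by (simp add: val)
  then show "cmod (F 0) \<le> R ^ degree P * cmod (h 0)"
    by (simp add: P(3) norm_mult mult_right_mono)
qed

text \<open>The gain of a factor \<open>2\<close> per zero bounds the degree of \<open>P\<close>. A splitting of greatest degree leaves no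
  zero in the disc, for a real zero, or a conjugate pair, of \<open>h\<close> could be moved into \<open>P\<close>.\<close>

lemma root_split_exists:
  assumes F: "F holomorphic_on UNIV" "conj_symmetric F" "F 0 \<noteq> 0" and R: "R > 0"
  obtains P h where "root_split F R P h" "\<And>z. cmod z \<le> R \<Longrightarrow> h z \<noteq> 0" "conj_symmetric h"
proof -
  have "compact (F ` sphere 0 (3 * R))"
    using F(1) by (intro compact_continuous_image)
      (auto intro: holomorphic_on_imp_continuous_on continuous_on_subset)
  then obtain M where "\<forall>x\<in>sphere 0 (3 * R). cmod (F x) \<le> M"
    by (auto dest!: compact_imp_bounded simp: bounded_iff)
  then have M: "cmod (F z) \<le> M" if "cmod z = 3 * R" for z
    using that by simp
  define Good where "Good n \<longleftrightarrow> (\<exists>P h. root_split F R P h \<and> degree P = n)" for n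
  have "Good 0"
    unfolding Good_def root_split_def using F(1)
    by (intro exI[of _ 1] exI[of _ F]) (auto simp: real_coeffs_def)
  obtain K where K: "M / cmod (F 0) < 2 ^ K"
    using real_arch_pow[of 2] by auto
  have "n \<le> K" if "Good n" for n
  proof (rule ccontr)
    assume "\<not> n \<le> K"
    then have "(2::real) ^ K \<le> 2 ^ n" by (intro power_increasing) auto
    obtain P h where Ph: "root_split F R P h" "degree P = n"
      using \<open>Good n\<close> by (auto simp: Good_def)
    have "cmod (F 0) \<le> R ^ n * cmod (h 0)" "cmod (h 0) \<le> M / (2 * R) ^ n"
      using root_split_bounds[OF Ph(1) R M] R Ph(2) by auto
    then have "cmod (F 0) \<le> R ^ n * (M / (2 * R) ^ n)"
      using R by (meson mult_left_mono order_trans zero_le_power less_imp_le)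
    also have "\<dots> = M / 2 ^ n"
      using R by (simp add: power_mult_distrib)
    finally have "2 ^ n \<le> M / cmod (F 0)"
      using F(3) by (simp add: field_simps)
    then show False using K \<open>2 ^ K \<le> 2 ^ n\<close> by linarith
  qed
  then obtain n where n: "Good n" "\<And>k. Good k \<Longrightarrow> k \<le> n"
    using GreatestI_nat[of Good 0 K] Greatest_le_nat[of Good _ K] \<open>Good 0\<close> by blast
  obtain P h where Ph: "root_split F R P h" "degree P = n"
    using n(1) by (auto simp: Good_def)
  have P: "real_coeffs P" "lead_coeff P = 1" "h holomorphic_on UNIV" "\<And>z. F z = poly P z * h z"
    "\<And>z. poly P z = 0 \<Longrightarrow> cmod z \<le> R"
    using Ph(1) by (auto simp: root_split_def)
  have P0: "P \<noteq> 0" using P(2) by auto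
  have sym: "conj_symmetric h"
    using conj_symmetric_cofactor[OF P(3,1) P0 F(2) P(4)] .
  have no: False if Q: "real_coeffs Q" "lead_coeff Q = 1" "degree Q > 0" "k holomorphic_on UNIV"
      "\<And>z. h z = poly Q z * k z" "\<And>z. poly Q z = 0 \<Longrightarrow> cmod z \<le> R" for Q k
  proof -
    have "root_split F R (P * Q) k"
      using P Q by (auto simp: root_split_def real_coeffs_mult lead_coeff_mult)
    moreover have "degree (P * Q) = n + degree Q"
      using P0 Q(3) Ph(2) by (subst degree_mult_eq) auto
    ultimately have "Good (n + degree Q)"
      by (auto simp: Good_def)
    then show False using n(2) Q(3) by force
  qed
  have "h \<alpha> \<noteq> 0" if \<alpha>: "cmod \<alpha> \<le> R" for \<alpha>
  proof
    assume h0: "h \<alpha> = 0"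
    obtain k where k: "k holomorphic_on UNIV" "\<And>z. h z = (z - \<alpha>) * k z"
      using factor_out_zero[OF P(3) h0] by blast
    show False
    proof (cases "Im \<alpha> = 0")
      case True
      then have "of_real (Re \<alpha>) = \<alpha>" by (simp add: complex_eq_iff)
      then have "real_coeffs [:- \<alpha>, 1:]"
        using real_coeffs_linear[of "Re \<alpha>"] by simp
      then show False
        using no[of "[:- \<alpha>, 1:]" k] k \<alpha> by auto
    next
      case False
      have "h (cnj \<alpha>) = 0" using sym h0 by (simp add: conj_symmetric_def)
      then have "k (cnj \<alpha>) = 0"
        using k(2)[of "cnj \<alpha>"] False by (auto simp: complex_eq_iff)
      then obtain l where l: "l holomorphic_on UNIV" "\<And>z. k z = (z - cnj \<alpha>) * l z"
        using factor_out_zero[OF k(1)] by blast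
      have eval: "poly (conj_quadratic \<alpha>) z = (z - \<alpha>) * (z - cnj \<alpha>)" for z
        unfolding conj_quadratic_eq poly_mult by simp
      show False
      proof (rule no[of "conj_quadratic \<alpha>" l])
        show "h z = poly (conj_quadratic \<alpha>) z * l z" for z
          by (simp add: eval k(2) l(2))
        show "cmod z \<le> R" if "poly (conj_quadratic \<alpha>) z = 0" for z
          using that \<alpha> by (auto simp: eval)
        show "lead_coeff (conj_quadratic \<alpha>) = 1" by (simp add: conj_quadratic_def)
      qed (use l real_coeffs_conj_quadratic degree_conj_quadratic in auto)
    qed
  qed
  then show ?thesis using that Ph(1) sym by blast
qed

section \<open>Polynomial approximation of functions of order less than two\<close>

text \<open>The Moebius map \<open>u \<mapsto> u / (2 B - u)\<close> sends the half-plane \<open>Re u < B\<close> into the unit disc, so that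
  Schwarz's lemma applies.\<close>

lemma borel_caratheodory_half_disc:
  assumes G: "G holomorphic_on ball 0 R" "G 0 = 0" and R: "R > 0" and B: "B > 0"
    and Re: "\<And>z. cmod z < R \<Longrightarrow> Re (G z) < B" and z: "cmod z \<le> R / 2"
  shows "cmod (G z) \<le> 2 * B"
proof -
  define \<phi> where "\<phi> \<zeta> = G (of_real R * \<zeta>) / (2 * of_real B - G (of_real R * \<zeta>))" for \<zeta>
  have inb: "cmod (of_real R * \<zeta>) < R" if "cmod \<zeta> < 1" for \<zeta>
    using that R by (simp add: norm_mult)
  have less: "cmod (G w) < cmod (2 * of_real B - G w)" if "cmod w < R" for w
  proof -
    have "(cmod (2 * of_real B - G w))\<^sup>2 - (cmod (G w))\<^sup>2 = 4 * B * (B - Re (G w))"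
      unfolding cmod_power2 by (simp add: power2_eq_square algebra_simps)
    also have "\<dots> > 0" using B Re[OF that] by simp
    finally show ?thesis
      using power2_less_imp_less[of "cmod (G w)" "cmod (2 * of_real B - G w)"] by simp
  qed
  have holG: "(\<lambda>\<zeta>. G (of_real R * \<zeta>)) holomorphic_on ball 0 1"
  proof (rule holomorphic_on_compose_gen[unfolded o_def, OF _ G(1)])
    show "(*) (of_real R :: complex) ` ball 0 1 \<subseteq> ball 0 R"
      using inb by (auto simp: image_subset_iff)
  qed (auto intro!: holomorphic_intros)
  define \<xi> where "\<xi> = z / of_real R"
  have \<xi>: "cmod \<xi> \<le> 1 / 2" "of_real R * \<xi> = z"
    using z R by (auto simp: \<xi>_def norm_divide field_simps)
  have "cmod (\<phi> \<xi>) \<le> cmod \<xi>"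
  proof (rule Schwarz_Lemma(1))
    show "\<phi> holomorphic_on ball 0 1"
      unfolding \<phi>_def using less inb holG by (intro holomorphic_intros) fastforce+
    show "\<phi> 0 = 0" by (simp add: \<phi>_def G(2))
    show "cmod \<xi> < 1" using \<xi>(1) by simp
    fix \<zeta> :: complex assume "cmod \<zeta> < 1"
    then have *: "cmod (G (of_real R * \<zeta>)) < cmod (2 * of_real B - G (of_real R * \<zeta>))"
      using less inb by blast
    then have "cmod (2 * of_real B - G (of_real R * \<zeta>)) > 0"
      using norm_ge_zero[of "G (of_real R * \<zeta>)"] by linarith
    then show "cmod (\<phi> \<zeta>) < 1"
      using * unfolding \<phi>_def norm_divide by (subst divide_less_eq_1_pos) auto
  qed
  then have "cmod (\<phi> \<xi>) \<le> 1 / 2" using \<xi>(1) by linarith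
  moreover have "cmod (\<phi> \<xi>) = cmod (G z) / cmod (2 * of_real B - G z)"
    by (simp add: \<phi>_def \<xi>(2) norm_divide)
  moreover have "cmod (2 * of_real B - G z) > 0"
    using less[of z] z R norm_ge_zero[of "G z"] by linarith
  ultimately have "2 * cmod (G z) \<le> cmod (2 * of_real B - G z)"
    by (simp add: field_simps)
  also have "\<dots> \<le> 2 * B + cmod (G z)"
    using norm_triangle_ineq4[of "2 * of_real B :: complex" "G z"] B by (simp add: norm_mult)
  finally show ?thesis by simp
qed

text \<open>The second derivative is estimated by Cauchy's inequality from the bound on the half disc. If
  \<open>B\<close> grows more slowly than \<open>R\<^sup>2\<close>, the deviation from linearity tends to \<open>0\<close> at fixed \<open>z\<close>.\<close>

lemma near_linear:
  assumes G: "G holomorphic_on ball 0 R" "G 0 = 0" and R: "R > 0" and B: "B > 0"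
    and Re: "\<And>z. cmod z < R \<Longrightarrow> Re (G z) < B" and z: "cmod z < R / 4"
  shows "cmod (G z - deriv G 0 * z) \<le> 64 * B / R\<^sup>2 * (cmod z)\<^sup>2"
proof -
  have "cmod ((deriv ^^ 0) G z - (\<Sum>i\<le>1. (deriv ^^ i) G 0 * (z - 0) ^ i / fact i))
          \<le> (64 * B / R\<^sup>2) * cmod (z - 0) ^ Suc 1 / fact 1"
  proof (rule complex_Taylor[where S = "ball 0 (R / 4)" and f = "\<lambda>i. (deriv ^^ i) G"])
    fix i :: nat and x :: complex assume x: "x \<in> ball 0 (R / 4)"
    have "((deriv ^^ i) G has_field_derivative (deriv ^^ Suc i) G x) (at x)"
      using has_field_derivative_higher_deriv[OF G(1), of x i] x R by simp
    then show "((deriv ^^ i) G has_field_derivative (deriv ^^ Suc i) G x) (at x within ball 0 (R / 4))"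
      by (rule has_field_derivative_at_within)
  next
    fix x :: complex assume x: "x \<in> ball 0 (R / 4)"
    have sub: "cmod y \<le> R / 2" if "cmod (x - y) \<le> R / 4" for y
      using norm_triangle_ineq2[of y x] that x by (simp add: norm_minus_commute)
    have subset: "cball x (R / 4) \<subseteq> ball 0 R"
    proof
      fix y assume "y \<in> cball x (R / 4)"
      then have "cmod y \<le> R / 2" using sub by (simp add: dist_norm)
      then show "y \<in> ball 0 R" using R by simp
    qed
    have "cmod ((deriv ^^ 2) G x) \<le> fact 2 * (2 * B) / (R / 4) ^ 2"
    proof (rule Cauchy_inequality)
      show "G holomorphic_on ball x (R / 4)"
        by (rule holomorphic_on_subset[OF G(1) order_trans[OF ball_subset_cball subset]])
      show "continuous_on (cball x (R / 4)) G"
        by (rule continuous_on_subset[OF holomorphic_on_imp_continuous_on[OF G(1)] subset])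
      show "cmod (G y) \<le> 2 * B" if "cmod (x - y) = R / 4" for y
        using borel_caratheodory_half_disc[OF G R B Re sub] that by simp
    qed (use R in simp)
    then show "cmod ((deriv ^^ Suc 1) G x) \<le> 64 * B / R\<^sup>2"
      using R by (simp add: numeral_2_eq_2 power_divide)
  qed (use z R in auto)
  then show ?thesis by (simp add: G(2) power2_eq_square)
qed

lemma exp_compound_bound:
  fixes w :: complex
  assumes "m > 0"
  shows "cmod (exp w - (1 + w / of_nat m) ^ m) \<le> exp (cmod w) * (cmod w)\<^sup>2 / real m"
proof -
  define v where "v = w / of_nat m"
  define K where "K = exp (cmod v)"
  have K: "K > 0" "K ^ m = exp (cmod w)"
    using assms by (auto simp: K_def v_def norm_divide exp_of_nat_mult[symmetric])
  have u: "exp w = exp v ^ m"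
    using assms by (simp add: v_def exp_of_nat_mult[symmetric])
  have b1: "cmod (exp v / of_real K) \<le> 1"
    using norm_exp[of v] K(1) by (simp add: norm_divide K_def)
  have "cmod (1 + v) \<le> 1 + cmod v"
    using norm_triangle_ineq[of 1 v] by simp
  also have "\<dots> \<le> K" by (simp add: K_def)
  finally have b2: "cmod ((1 + v) / of_real K) \<le> 1"
    using K(1) by (simp add: norm_divide)
  have t: "cmod (exp v - (1 + v)) \<le> K * (cmod v)\<^sup>2"
    using Taylor_exp_field[of v 1] by (simp add: K_def power2_eq_square)
  have "cmod ((exp v / of_real K) ^ m - ((1 + v) / of_real K) ^ m)
      \<le> of_nat m * cmod (exp v / of_real K - (1 + v) / of_real K)"
    using norm_power_diff[OF b1 b2] .
  also have "\<dots> = of_nat m * (cmod (exp v - (1 + v)) / K)"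
    using K(1) by (simp add: diff_divide_distrib[symmetric] norm_divide)
  also have "\<dots> \<le> of_nat m * (K * (cmod v)\<^sup>2 / K)"
    using t K(1) by (intro mult_left_mono divide_right_mono) auto
  also have "\<dots> = (cmod w)\<^sup>2 / real m"
    using K(1) assms by (simp add: v_def norm_divide power_divide power2_eq_square)
  finally have "cmod ((exp v ^ m - (1 + v) ^ m) / of_real K ^ m) \<le> (cmod w)\<^sup>2 / real m"
    by (simp add: power_divide diff_divide_distrib)
  then have "cmod (exp v ^ m - (1 + v) ^ m) / K ^ m \<le> (cmod w)\<^sup>2 / real m"
    using K(1) by (simp add: norm_divide norm_power)
  then have "cmod (exp v ^ m - (1 + v) ^ m) \<le> (cmod w)\<^sup>2 / real m * K ^ m"
    using K(1) by (subst (asm) pos_divide_le_eq) auto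
  then show ?thesis
    unfolding u v_def[symmetric] K(2) by (simp add: mult_ac)
qed

text \<open>An upper bound \<open>o(|z|\<^sup>2)\<close> for \<open>ln |F z|\<close>, the form in which an order below \<open>2\<close> enters the
  approximation.\<close>

definition subquadratic_growth :: "(complex \<Rightarrow> complex) \<Rightarrow> bool" where
  "subquadratic_growth F \<longleftrightarrow> (\<forall>\<epsilon>>0. \<exists>A. \<forall>z. cmod (F z) \<le> A * exp (\<epsilon> * (cmod z)\<^sup>2))"

text \<open>In \<open>F = P h\<close> with \<open>h\<close> free of zeros on \<open>cball 0 R\<close> write \<open>h = h 0 * exp G\<close>. The real part of \<open>G\<close> is
  bounded by \<open>ln (M / |F 0|)\<close>, \<open>M\<close> a bound of \<open>|F|\<close> for \<open>|z| = 3 R\<close>, and this is \<open>o(R\<^sup>2)\<close>. So \<open>G\<close> differs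
  from the linear \<open>a z\<close> by a small \<open>E\<close>; the slope \<open>a = h' 0 / h 0\<close> and \<open>c = h 0\<close> are real by
  symmetry.\<close>

lemma exponential_polynomial_approximation:
  assumes F: "F holomorphic_on UNIV" "conj_symmetric F" "F 0 \<noteq> 0" "subquadratic_growth F"
    and S: "S > 0" and \<delta>: "0 < \<delta>" "\<delta> \<le> 1"
  obtains P and c a :: real where "real_coeffs P" "P \<noteq> 0" "\<And>z. poly P z = 0 \<Longrightarrow> F z = 0" "c \<noteq> 0"
    "\<And>z. cmod z \<le> S \<Longrightarrow> \<exists>E. cmod E \<le> \<delta> \<and> F z = of_real c * exp (of_real a * z) * poly P z * exp E"
proof -
  \<comment> \<open>The deviation \<open>64 B S\<^sup>2 / R\<^sup>2\<close> with \<open>B = b + 9 \<epsilon> R\<^sup>2\<close> is to be at most \<open>\<delta>\<close>: the choices of \<open>\<epsilon>\<close> and of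
    \<open>R\<close> each use up one half of \<open>\<delta>\<close>.\<close>
  define \<epsilon> where "\<epsilon> = \<delta> / (1152 * S\<^sup>2)"
  have \<epsilon>: "\<epsilon> > 0" using \<delta> S by (simp add: \<epsilon>_def)
  obtain A where A: "\<And>z. cmod (F z) \<le> A * exp (\<epsilon> * (cmod z)\<^sup>2)"
    using F(4) \<epsilon> by (auto simp: subquadratic_growth_def)
  have AF: "cmod (F 0) \<le> A" using A[of 0] by simp
  then have A0: "A > 0" using F(3) by (meson less_le_trans zero_less_norm_iff)
  define b where "b = ln (A / cmod (F 0)) + 1"
  have b: "b \<ge> 1" using AF F(3) by (simp add: b_def)
  define R where "R = max (5 * S) (sqrt (128 * S\<^sup>2 * b / \<delta>))"
  have R: "R > 0" "S < R / 4" using S by (auto simp: R_def)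
  have R2: "128 * S\<^sup>2 * b / \<delta> \<le> R\<^sup>2"
  proof -
    have "128 * S\<^sup>2 * b / \<delta> = (sqrt (128 * S\<^sup>2 * b / \<delta>))\<^sup>2"
      using b \<delta> by simp
    also have "\<dots> \<le> R\<^sup>2"
      using b \<delta> by (intro power_mono) (auto simp: R_def)
    finally show ?thesis .
  qed
  define B where "B = b + \<epsilon> * (3 * R)\<^sup>2"
  have B: "B > 0" using b \<epsilon> by (simp add: B_def add_pos_nonneg)
  have small: "64 * B / R\<^sup>2 * S\<^sup>2 \<le> \<delta>"
  proof -
    have "64 * B / R\<^sup>2 * S\<^sup>2 = 64 * S\<^sup>2 * b / R\<^sup>2 + 576 * \<epsilon> * S\<^sup>2"
      using R(1) by (simp add: B_def field_simps power2_eq_square)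
    also have "576 * \<epsilon> * S\<^sup>2 = \<delta> / 2"
      using S by (simp add: \<epsilon>_def)
    also have "64 * S\<^sup>2 * b / R\<^sup>2 \<le> \<delta> / 2"
      using R2 R(1) \<delta> by (simp add: field_simps)
    finally show ?thesis by simp
  qed
  obtain P h where Ph: "root_split F R P h" "\<And>z. cmod z \<le> R \<Longrightarrow> h z \<noteq> 0" "conj_symmetric h"
    using root_split_exists[OF F(1-3) R(1)] by blast
  have P: "real_coeffs P" "lead_coeff P = 1" "h holomorphic_on UNIV" "\<And>z. F z = poly P z * h z"
    using Ph(1) by (auto simp: root_split_def)
  define M where "M = A * exp (\<epsilon> * (3 * R)\<^sup>2)"
  have M: "cmod (F z) \<le> M" if "cmod z = 3 * R" for z
    using A[of z] that by (simp add: M_def)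
  have M0: "M > 0" using A0 by (simp add: M_def)
  have h0: "h 0 \<noteq> 0" using Ph(2)[of 0] R by simp
  have ratio: "cmod (h z / h 0) \<le> M / cmod (F 0)" if "cmod z \<le> 3 * R" for z
  proof -
    have 1: "cmod (h z) \<le> M / (2 * R) ^ degree P" and 2: "cmod (F 0) \<le> R ^ degree P * cmod (h 0)"
      using root_split_bounds[OF Ph(1) R(1) M] that by auto
    have "cmod (h z) * cmod (F 0) \<le> M / (2 * R) ^ degree P * (R ^ degree P * cmod (h 0))"
      using 1 2 M0 R by (intro mult_mono) auto
    also have "\<dots> = M * cmod (h 0) / 2 ^ degree P"
      using R(1) by (simp add: power_mult_distrib)
    also have "\<dots> \<le> M * cmod (h 0) / 1"
      using M0 by (intro divide_left_mono) auto
    finally show ?thesis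
      using h0 F(3) by (simp add: norm_divide field_simps)
  qed
  have "simply_connected (ball (0::complex) R)" "locally path_connected (ball (0::complex) R)"
    by (auto intro: convex_imp_simply_connected open_imp_locally_path_connected)
  then obtain g where g: "g holomorphic_on ball 0 R" "\<And>z. z \<in> ball 0 R \<Longrightarrow> h z = exp (g z)"
    using simply_connected_imp_holomorphic_log[of h "ball 0 R"] P(3) Ph(2)
    by (metis holomorphic_on_subset less_imp_le mem_ball_0 subset_UNIV)
  define G where "G z = g z - g 0" for z
  have G: "G holomorphic_on ball 0 R" "G 0 = 0"
    unfolding G_def using g(1) by (auto intro!: holomorphic_intros)
  have hG: "h z = h 0 * exp (G z)" if "cmod z < R" for z
    using g(2)[of z] g(2)[of 0] that R by (simp add: G_def exp_diff)
  have ReG: "Re (G z) < B" if "cmod z < R" for z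
  proof -
    have "exp (Re (G z)) = cmod (h z / h 0)"
      using hG[OF that] h0 by simp
    also have "\<dots> \<le> M / cmod (F 0)"
      using ratio that R by simp
    also have "\<dots> = exp (ln (A / cmod (F 0)) + \<epsilon> * (3 * R)\<^sup>2)"
      using A0 F(3) by (simp add: exp_add M_def)
    finally have "Re (G z) \<le> ln (A / cmod (F 0)) + \<epsilon> * (3 * R)\<^sup>2" by simp
    then show ?thesis by (simp add: B_def b_def)
  qed
  have h0_real: "h 0 \<in> \<real>"
    using Ph(3) by (metis conj_symmetric_def complex_cnj_zero Reals_cnj_iff)
  have dG: "deriv h 0 = h 0 * deriv G 0"
  proof -
    have "(G has_field_derivative deriv G 0) (at 0)"
      using G(1) R by (intro holomorphic_derivI[of _ "ball 0 R"]) auto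
    then have "((\<lambda>z. h 0 * exp (G z)) has_field_derivative h 0 * deriv G 0) (at 0)"
      using G(2) by (auto intro!: derivative_eq_intros)
    moreover have "eventually (\<lambda>z. z \<in> ball 0 R) (nhds (0::complex))"
      by (rule eventually_nhds_in_open) (use R in auto)
    then have "eventually (\<lambda>z. h z = h 0 * exp (G z)) (nhds 0)"
      by (rule eventually_mono) (rule hG, simp)
    ultimately have "(h has_field_derivative h 0 * deriv G 0) (at 0)"
      by (subst DERIV_cong_ev[OF refl _ refl]) auto
    then show ?thesis by (rule DERIV_imp_deriv)
  qed
  have "deriv h 0 \<in> \<real>"
  proof -
    have "cnj \<circ> h \<circ> cnj = h"
      using Ph(3) by (auto simp: conj_symmetric_def fun_eq_iff)
    moreover have "(h has_field_derivative deriv h 0) (at (cnj 0))"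
      unfolding complex_cnj_zero using P(3) by (intro holomorphic_derivI[of _ UNIV]) auto
    then have "((cnj \<circ> h \<circ> cnj) has_field_derivative cnj (deriv h 0)) (at 0)"
      by (simp add: has_field_derivative_cnj_cnj)
    ultimately have "deriv h 0 = cnj (deriv h 0)"
      using DERIV_imp_deriv by metis
    then show ?thesis by (metis Reals_cnj_iff)
  qed
  then have "deriv G 0 \<in> \<real>"
    using dG h0 h0_real by (metis Reals_divide nonzero_mult_div_cancel_left)
  then obtain a where a: "deriv G 0 = of_real a" by (auto elim: Reals_cases)
  obtain c where c: "h 0 = of_real c" using h0_real by (auto elim: Reals_cases)
  show ?thesis
  proof (rule that[of P c a])
    show "real_coeffs P" "P \<noteq> 0" using P by auto
    show "F z = 0" if "poly P z = 0" for z using P(4)[of z] that by simp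
    show "c \<noteq> 0" using h0 c by auto
    fix z assume z: "cmod z \<le> S"
    define E where "E = G z - deriv G 0 * z"
    have "cmod E \<le> 64 * B / R\<^sup>2 * (cmod z)\<^sup>2"
      unfolding E_def using near_linear[OF G R(1) B ReG, of z] z R by simp
    also have "\<dots> \<le> 64 * B / R\<^sup>2 * S\<^sup>2"
      using z B by (intro mult_left_mono power_mono) auto
    finally have "cmod E \<le> \<delta>" using small by linarith
    moreover have "F z = of_real c * exp (of_real a * z) * poly P z * exp E"
    proof -
      have "exp (G z) = exp (of_real a * z) * exp E"
        by (simp add: E_def a exp_add[symmetric])
      then show ?thesis
        using hG[of z] z R S P(4)[of z] by (simp add: c mult_ac)
    qed
    ultimately show "\<exists>E. cmod E \<le> \<delta> \<and> F z = of_real c * exp (of_real a * z) * poly P z * exp E"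
      by blast
  qed
qed

lemma continuous_bound_on_cball:
  fixes f :: "complex \<Rightarrow> complex"
  assumes "continuous_on UNIV f"
  obtains K where "K > 0" "\<And>z. cmod z \<le> S \<Longrightarrow> cmod (f z) \<le> K"
proof -
  have "compact (f ` cball 0 S)"
    using assms by (intro compact_continuous_image) (auto intro: continuous_on_subset)
  then obtain K where "K > 0" "\<forall>y\<in>f ` cball 0 S. cmod y \<le> K"
    using compact_imp_bounded bounded_pos by blast
  then show ?thesis using that[of K] by simp
qed

lemma real_coeffs_power: "real_coeffs p \<Longrightarrow> real_coeffs (p ^ n)"
proof (induction n)
  case 0
  show ?case by (auto simp: real_coeffs_def)
next
  case (Suc n)
  then show ?case by (simp add: real_coeffs_mult)
qed

lemma real_coeffs_smult: "real_coeffs p \<Longrightarrow> real_coeffs (smult (of_real c) p)"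
  by (simp add: real_coeffs_def Reals_mult)

lemma real_coeffs_pcompose: "real_coeffs p \<Longrightarrow> real_coeffs q \<Longrightarrow> real_coeffs (pcompose p q)"
proof (induction p)
  case (pCons a p)
  have a: "a \<in> \<real>" and p: "real_coeffs p"
    using pCons.prems(1) by (auto simp: real_coeffs_def coeff_pCons split: nat.splits dest: spec[of _ 0] spec[of _ "Suc _"])
  have "real_coeffs (q * pcompose p q)"
    using pCons.IH[OF p pCons.prems(2)] pCons.prems(2) by (rule real_coeffs_mult[rotated])
  then show ?case
    using a by (auto simp: pcompose_pCons real_coeffs_def coeff_pCons split: nat.splits)
qed (simp add: real_coeffs_def)

text \<open>The factor \<open>exp (a z)\<close> is replaced by \<open>(1 + a z / m)\<^sup>m\<close>, whose only zero is real.\<close>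

lemma polynomial_approximation_nonzero_at_0:
  assumes F: "F holomorphic_on UNIV" "conj_symmetric F" "F 0 \<noteq> 0" "subquadratic_growth F"
    and S: "S > 0" and \<epsilon>: "\<epsilon> > 0"
  obtains p where "real_coeffs p" "\<And>z. poly p z = 0 \<Longrightarrow> Im z \<noteq> 0 \<Longrightarrow> F z = 0"
    "\<And>z. cmod z \<le> S \<Longrightarrow> cmod (F z - poly p z) \<le> \<epsilon>"
proof -
  obtain K where K: "K > 0" "\<And>z. cmod z \<le> S \<Longrightarrow> cmod (F z) \<le> K"
    using continuous_bound_on_cball[OF holomorphic_on_imp_continuous_on[OF F(1)]] by blast
  \<comment> \<open>One half of \<open>\<epsilon>\<close> is spent on the factor \<open>exp E\<close>, the other on the compound power.\<close>
  define \<delta> where "\<delta> = min 1 (\<epsilon> / (6 * K))"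
  have \<delta>: "0 < \<delta>" "\<delta> \<le> 1" "3 * K * \<delta> \<le> \<epsilon> / 2"
    using \<epsilon> K(1) by (auto simp: \<delta>_def min_def field_simps)
  obtain P and c a :: real where P: "real_coeffs P" "P \<noteq> 0" "\<And>z. poly P z = 0 \<Longrightarrow> F z = 0" "c \<noteq> 0"
    "\<And>z. cmod z \<le> S \<Longrightarrow> \<exists>E. cmod E \<le> \<delta> \<and> F z = of_real c * exp (of_real a * z) * poly P z * exp E"
    using exponential_polynomial_approximation[OF F S \<delta>(1,2)] by blast
  define T where "T z = of_real c * exp (of_real a * z) * poly P z" for z
  have FT: "cmod (F z - T z) \<le> \<epsilon> / 2" if z: "cmod z \<le> S" for z
  proof -
    obtain E where E: "cmod E \<le> \<delta>" "F z = T z * exp E"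
      using P(5)[OF z] by (auto simp: T_def)
    have "T z = F z * exp (- E)"
      using E(2) by (simp add: exp_minus field_simps)
    then have "cmod (F z - T z) = cmod (F z) * cmod (exp (- E) - 1)"
      by (simp add: norm_mult[symmetric] algebra_simps norm_minus_commute)
    also have "\<dots> \<le> K * (exp (cmod E) * cmod E)"
      using K(2)[OF z] Taylor_exp_field[of "- E" 0] K(1) by (intro mult_mono) auto
    also have "\<dots> \<le> K * (exp 1 * \<delta>)"
      using E(1) \<delta> K(1) by (intro mult_left_mono mult_mono) auto
    also have "\<dots> \<le> K * (3 * \<delta>)"
      using exp_le K(1) \<delta>(1) by (intro mult_left_mono mult_right_mono) auto
    also have "\<dots> \<le> \<epsilon> / 2" using \<delta>(3) by simp
    finally show ?thesis .
  qed
  obtain K' where K': "K' > 0" "\<And>z. cmod z \<le> S \<Longrightarrow> cmod (poly P z) \<le> K'"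
    using continuous_bound_on_cball[OF continuous_on_poly[OF continuous_on_id, of UNIV P]] by blast
  define s where "s = \<bar>a\<bar> * S"
  define Q where "Q = \<bar>c\<bar> * (exp s * s\<^sup>2) * K'"
  have Q: "Q \<ge> 0" using K' by (simp add: Q_def)
  obtain m where m: "2 * Q / \<epsilon> < real m" using reals_Archimedean2 by blast
  then have m0: "m > 0" using Q \<epsilon> by (metis divide_nonneg_pos gr0I mult_nonneg_nonneg not_less of_nat_0 zero_le_numeral)
  define p where "p = smult (of_real c) (P * [:1, of_real (a / real m):] ^ m)"
  have eval: "poly p z = of_real c * (1 + of_real a * z / of_nat m) ^ m * poly P z" for z
    by (simp add: p_def mult_ac)
  show ?thesis
  proof (rule that[of p])
    have "real_coeffs [:1, of_real (a / real m):]"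
      by (auto simp: real_coeffs_def coeff_pCons split: nat.splits)
    then show "real_coeffs p"
      unfolding p_def by (intro real_coeffs_smult real_coeffs_mult P(1) real_coeffs_power)
    show "F z = 0" if "poly p z = 0" "Im z \<noteq> 0" for z
    proof -
      have "1 + of_real a * z / of_nat m \<noteq> 0"
      proof
        assume eq: "1 + of_real a * z / of_nat m = 0"
        then have "of_nat m + of_real a * z = 0"
          using m0 by (simp add: field_simps)
        then have "a * Im z = 0" and "real m + a * Re z = 0"
          by (auto simp: complex_eq_iff)
        then have "a = 0" "a \<noteq> 0"
          using that(2) m0 by auto
        then show False by simp
      qed
      then show ?thesis using that(1) P(3,4) by (simp add: eval)
    qed
    fix z assume z: "cmod z \<le> S"
    define w where "w = of_real a * z"
    have w: "cmod w \<le> s"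
      using z by (simp add: w_def s_def norm_mult mult_left_mono)
    have "T z - poly p z = of_real c * (exp w - (1 + w / of_nat m) ^ m) * poly P z"
      unfolding T_def eval w_def by (simp add: algebra_simps)
    then have "cmod (T z - poly p z) = \<bar>c\<bar> * cmod (exp w - (1 + w / of_nat m) ^ m) * cmod (poly P z)"
      by (simp add: norm_mult)
    also have "\<dots> \<le> \<bar>c\<bar> * (exp s * s\<^sup>2 / real m) * K'"
    proof (intro mult_mono mult_left_mono)
      have "cmod (exp w - (1 + w / of_nat m) ^ m) \<le> exp (cmod w) * (cmod w)\<^sup>2 / real m"
        using exp_compound_bound[OF m0] .
      also have "\<dots> \<le> exp s * s\<^sup>2 / real m"
        using w by (intro divide_right_mono mult_mono power_mono) auto
      finally show "cmod (exp w - (1 + w / of_nat m) ^ m) \<le> exp s * s\<^sup>2 / real m" .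
    qed (use K' z in auto)
    also have "\<dots> = Q / real m" by (simp add: Q_def)
    also have "\<dots> \<le> \<epsilon> / 2" using m m0 \<epsilon> by (simp add: field_simps)
    finally have "cmod (T z - poly p z) \<le> \<epsilon> / 2" .
    then show "cmod (F z - poly p z) \<le> \<epsilon>"
      using FT[OF z] norm_triangle_ineq[of "F z - T z" "T z - poly p z"] by simp
  qed
qed

lemma subquadratic_growth_shift:
  assumes "subquadratic_growth F"
  shows "subquadratic_growth (\<lambda>z. F (z + b))"
  unfolding subquadratic_growth_def
proof (intro allI impI)
  fix \<epsilon> :: real assume \<epsilon>: "\<epsilon> > 0"
  then obtain A where A: "\<And>z. cmod (F z) \<le> A * exp (\<epsilon> / 2 * (cmod z)\<^sup>2)"
    using assms[unfolded subquadratic_growth_def, rule_format, of "\<epsilon> / 2"] by auto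
  have A0: "A \<ge> 0" using order_trans[OF norm_ge_zero A[of 0]] by simp
  have "cmod (F (z + b)) \<le> A * exp (\<epsilon> * (cmod b)\<^sup>2) * exp (\<epsilon> * (cmod z)\<^sup>2)" for z
  proof -
    have "(cmod (z + b))\<^sup>2 \<le> (cmod z + cmod b)\<^sup>2"
      by (intro power_mono norm_triangle_ineq) auto
    also have "\<dots> \<le> 2 * ((cmod b)\<^sup>2 + (cmod z)\<^sup>2)"
      using sum_squares_bound[of "cmod z" "cmod b"] by (simp add: power2_sum)
    finally have "\<epsilon> / 2 * (cmod (z + b))\<^sup>2 \<le> \<epsilon> / 2 * (2 * ((cmod b)\<^sup>2 + (cmod z)\<^sup>2))"
      using \<epsilon> by (intro mult_left_mono) auto
    then have "exp (\<epsilon> / 2 * (cmod (z + b))\<^sup>2) \<le> exp (\<epsilon> * (cmod b)\<^sup>2) * exp (\<epsilon> * (cmod z)\<^sup>2)"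
      by (simp add: exp_add[symmetric] algebra_simps)
    then show ?thesis
      using A[of "z + b"] A0 by (smt (verit) mult.assoc mult_left_mono)
  qed
  then show "\<exists>A. \<forall>z. cmod (F (z + b)) \<le> A * exp (\<epsilon> * (cmod z)\<^sup>2)" by blast
qed

lemma polynomial_approximation:
  fixes x :: real
  assumes F: "F holomorphic_on UNIV" "conj_symmetric F" "F (of_real x) \<noteq> 0" "subquadratic_growth F"
    and S: "S > 0" and \<epsilon>: "\<epsilon> > 0"
  obtains p where "real_coeffs p" "\<And>z. poly p z = 0 \<Longrightarrow> Im z \<noteq> 0 \<Longrightarrow> F z = 0"
    "\<And>z. cmod z \<le> S \<Longrightarrow> cmod (F z - poly p z) \<le> \<epsilon>"
proof -
  define G where "G z = F (z + of_real x)" for z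
  have "G holomorphic_on UNIV"
    unfolding G_def
    by (rule holomorphic_on_compose_gen[unfolded o_def, OF _ F(1)]) (auto intro!: holomorphic_intros)
  moreover have "conj_symmetric G"
    using F(2) unfolding conj_symmetric_def G_def by (metis complex_cnj_add complex_cnj_complex_of_real)
  moreover have "G 0 \<noteq> 0" using F(3) by (simp add: G_def)
  moreover have "subquadratic_growth G"
    unfolding G_def by (rule subquadratic_growth_shift[OF F(4)])
  moreover have "S + \<bar>x\<bar> > 0" using S by simp
  ultimately obtain p where p: "real_coeffs p" "\<And>z. poly p z = 0 \<Longrightarrow> Im z \<noteq> 0 \<Longrightarrow> G z = 0"
    "\<And>z. cmod z \<le> S + \<bar>x\<bar> \<Longrightarrow> cmod (G z - poly p z) \<le> \<epsilon>"
    using polynomial_approximation_nonzero_at_0[of G "S + \<bar>x\<bar>" \<epsilon>] \<epsilon> by blast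
  define q where "q = pcompose p [:- of_real x, 1:]"
  have q: "poly q z = poly p (z - of_real x)" for z
    by (simp add: q_def poly_pcompose)
  show ?thesis
  proof (rule that[of q])
    show "real_coeffs q"
      unfolding q_def by (intro real_coeffs_pcompose p(1) real_coeffs_linear)
    show "F z = 0" if "poly q z = 0" "Im z \<noteq> 0" for z
      using p(2)[of "z - of_real x"] that by (simp add: q G_def)
    show "cmod (F z - poly q z) \<le> \<epsilon>" if "cmod z \<le> S" for z
    proof -
      have "cmod (z - of_real x) \<le> S + \<bar>x\<bar>"
        using norm_triangle_ineq4[of z "of_real x"] that by simp
      from p(3)[OF this] show ?thesis by (simp add: q G_def)
    qed
  qed
qed

section \<open>Nonreal zeros of high derivatives are far away\<close>

text \<open>If the last inequality failed, \<open>|p|\<close> would be at most \<open>2 A exp n\<close> on the disc of radius \<open>10 D\<close>, and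
  \<open>|p x|\<close> at most \<open>2 A (e / 9)\<^sup>n \<le> 2 A / 3\<^sup>n\<close>, although \<open>p x\<close> is close to \<open>F x\<close>. How good the
  approximation must be depends only on \<open>F\<close>, and \<open>n\<^sub>0\<close> not on \<open>p\<close>.\<close>

lemma nonreal_zero_location:
  assumes A: "A > 0" and \<sigma>: "\<sigma> > 0" and growth: "\<And>z. cmod (F z) \<le> A * exp (cmod z powr \<sigma>)"
    and x: "F x \<noteq> 0"
  obtains n\<^sub>0 where "\<And>n p w. \<lbrakk>n \<ge> n\<^sub>0; real_coeffs p;
      \<And>z. cmod z \<le> real n powr (1 / \<sigma>) \<Longrightarrow> cmod (F z - poly p z) \<le> min A (cmod (F x) / 2);
      (pderiv ^^ n) p \<noteq> 0; poly ((pderiv ^^ n) p) w = 0; Im w \<noteq> 0\<rbrakk> \<Longrightarrow>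
      \<exists>w\<^sub>0. poly p w\<^sub>0 = 0 \<and> Im w\<^sub>0 \<noteq> 0 \<and> \<bar>Im w\<bar> \<le> \<bar>Im w\<^sub>0\<bar> \<and>
        cmod (w - w\<^sub>0) \<le> sqrt (2 * real n) * \<bar>Im w\<^sub>0\<bar> \<and>
        real n powr (1 / \<sigma>) < 10 * (cmod x + cmod w + 2 * sqrt (2 * real n) * \<bar>Im w\<^sub>0\<bar>)"
proof -
  obtain n0 where n0: "4 * A / cmod (F x) < 3 ^ n0"
    using real_arch_pow[of 3] by auto
  show ?thesis
  proof (rule that[of "max 1 n0"])
    fix n p w
    assume n: "max 1 n0 \<le> n" and p: "real_coeffs p"
      and approx: "\<And>z. cmod z \<le> real n powr (1 / \<sigma>) \<Longrightarrow> cmod (F z - poly p z) \<le> min A (cmod (F x) / 2)"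
      and w: "(pderiv ^^ n) p \<noteq> 0" "poly ((pderiv ^^ n) p) w = 0" "Im w \<noteq> 0"
    obtain w\<^sub>0 where w\<^sub>0: "poly p w\<^sub>0 = 0" "Im w\<^sub>0 \<noteq> 0" "\<bar>Im w\<bar> \<le> \<bar>Im w\<^sub>0\<bar>"
      "cmod (w - w\<^sub>0) \<le> sqrt (2 * real n) * \<bar>Im w\<^sub>0\<bar>"
      and dec: "\<And>M x D. cmod x + cmod w + 2 * sqrt (2 * real n) * \<bar>Im w\<^sub>0\<bar> \<le> D \<Longrightarrow>
       (\<And>z. cmod z \<le> 10 * D \<Longrightarrow> cmod (poly p z) \<le> M) \<Longrightarrow> cmod (poly p x) \<le> M / 9 ^ n"
      using nonreal_zero_of_higher_derivative[OF p w] by blast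
    define D where "D = cmod x + cmod w + 2 * sqrt (2 * real n) * \<bar>Im w\<^sub>0\<bar>"
    have "real n powr (1 / \<sigma>) < 10 * D"
    proof (rule ccontr)
      assume "\<not> real n powr (1 / \<sigma>) < 10 * D"
      then have D: "10 * D \<le> real n powr (1 / \<sigma>)" by simp
      have xD: "cmod x \<le> D" by (simp add: D_def)
      then have D0: "D \<ge> 0" using norm_ge_zero[of x] by linarith
      have "cmod (poly p z) \<le> 2 * A * exp (real n)" if z: "cmod z \<le> 10 * D" for z
      proof -
        have zn: "cmod z \<le> real n powr (1 / \<sigma>)" using z D by simp
        then have "cmod z powr \<sigma> \<le> (real n powr (1 / \<sigma>)) powr \<sigma>"
          using \<sigma> by (intro powr_mono2) auto
        then have pw: "cmod z powr \<sigma> \<le> real n"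
          using \<sigma> n by (simp add: powr_powr)
        have "cmod (poly p z) \<le> cmod (F z) + cmod (F z - poly p z)"
          using norm_triangle_ineq4[of "F z" "F z - poly p z"] by simp
        also have "\<dots> \<le> A * exp (cmod z powr \<sigma>) + A"
          using growth[of z] approx[OF zn] by simp
        also have "\<dots> \<le> A * exp (real n) + A * exp (real n)"
          using pw A by (intro add_mono mult_left_mono) auto
        finally show ?thesis by simp
      qed
      then have "cmod (poly p x) \<le> 2 * A * exp (real n) / 9 ^ n"
        using dec[of x D] by (simp add: D_def)
      also have "\<dots> \<le> 2 * A * 3 ^ n / 9 ^ n"
      proof -
        have "exp (real n) = exp 1 ^ n"
          using exp_of_nat_mult[of n "1::real"] by simp
        also have "\<dots> \<le> 3 ^ n" using exp_le by (intro power_mono) auto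
        finally show ?thesis using A by (intro divide_right_mono mult_left_mono) auto
      qed
      also have "(9::real) ^ n = 3 ^ n * 3 ^ n"
        by (simp add: power_mult_distrib[symmetric])
      also have "2 * A * 3 ^ n / (3 ^ n * 3 ^ n) = 2 * A / 3 ^ n" by simp
      finally have up: "cmod (poly p x) \<le> 2 * A / 3 ^ n" .
      have "cmod x \<le> real n powr (1 / \<sigma>)" using xD D D0 by linarith
      then have "cmod (F x - poly p x) \<le> cmod (F x) / 2" using approx by force
      then have "cmod (F x) / 2 \<le> cmod (poly p x)"
        using norm_triangle_ineq2[of "F x" "poly p x"] by simp
      with up have "cmod (F x) / 2 \<le> 2 * A / 3 ^ n" by linarith
      then have "cmod (F x) * 3 ^ n \<le> 4 * A"
        by (simp add: field_simps)
      moreover have "(3::real) ^ n0 \<le> 3 ^ n" using n by (intro power_increasing) auto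
      then have "4 * A / cmod (F x) < 3 ^ n" using n0 by linarith
      then have "4 * A < cmod (F x) * 3 ^ n"
        using x by (simp add: divide_less_eq mult.commute)
      ultimately show False by simp
    qed
    then show "\<exists>w\<^sub>0. poly p w\<^sub>0 = 0 \<and> Im w\<^sub>0 \<noteq> 0 \<and> \<bar>Im w\<bar> \<le> \<bar>Im w\<^sub>0\<bar> \<and>
        cmod (w - w\<^sub>0) \<le> sqrt (2 * real n) * \<bar>Im w\<^sub>0\<bar> \<and>
        real n powr (1 / \<sigma>) < 10 * (cmod x + cmod w + 2 * sqrt (2 * real n) * \<bar>Im w\<^sub>0\<bar>)"
      using w\<^sub>0 by (auto simp: D_def)
  qed
qed

section \<open>Hyperbolicity from the location of the nonreal zeros\<close>

lemma powr_dominates: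
  assumes "a < (b::real)" "\<epsilon> > 0"
  shows "\<forall>\<^sub>F t in at_top. t powr a \<le> \<epsilon> * t powr b"
proof -
  have "((\<lambda>t. t powr (- (b - a))) \<longlongrightarrow> 0) at_top"
    using assms(1) by (intro tendsto_neg_powr filterlim_ident) auto
  then have "\<forall>\<^sub>F t in at_top. t powr (- (b - a)) < \<epsilon>"
    using assms(2) by (rule order_tendstoD)
  then show ?thesis
    using eventually_gt_at_top[of 0]
  proof eventually_elim
    case (elim t)
    have "t powr a = t powr (- (b - a)) * t powr b"
      using elim by (simp add: powr_add[symmetric])
    then show ?case using elim by (simp add: mult_right_mono)
  qed
qed

lemma subquadratic_growthI:
  assumes growth: "\<And>z. cmod (F z) \<le> A * exp (cmod z powr \<sigma>)" and \<sigma>: "0 < \<sigma>" "\<sigma> < 2"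
  shows "subquadratic_growth F"
  unfolding subquadratic_growth_def
proof (intro allI impI)
  fix \<epsilon> :: real assume \<epsilon>: "\<epsilon> > 0"
  have A0: "A \<ge> 0" using order_trans[OF norm_ge_zero growth[of 0]] by (simp add: zero_le_mult_iff)
  obtain t0 where t0: "\<And>t. t \<ge> t0 \<Longrightarrow> t powr \<sigma> \<le> \<epsilon> * t powr 2"
    using powr_dominates[OF \<sigma>(2) \<epsilon>] by (auto simp: eventually_at_top_linorder)
  define C where "C = \<bar>t0\<bar> powr \<sigma>"
  have "t powr \<sigma> \<le> \<epsilon> * t\<^sup>2 + C" if "t \<ge> 0" for t
  proof (cases "t \<ge> t0")
    case True
    have "t powr 2 = t\<^sup>2"
      using that by (cases "t = 0") (auto simp: powr_numeral)
    with t0[OF True] have "t powr \<sigma> \<le> \<epsilon> * t\<^sup>2" by (simp only:)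
    moreover have "C \<ge> 0" by (simp add: C_def)
    ultimately show ?thesis by (rule add_increasing2[rotated])
  next
    case False
    then have "t powr \<sigma> \<le> C"
      unfolding C_def using that \<sigma> by (intro powr_mono2) auto
    moreover have "0 \<le> \<epsilon> * t\<^sup>2" using \<epsilon> by simp
    ultimately show ?thesis by linarith
  qed
  then have "A * exp (cmod z powr \<sigma>) \<le> A * exp (\<epsilon> * (cmod z)\<^sup>2 + C)" for z
    using A0 by (intro mult_left_mono) auto
  then have "cmod (F z) \<le> A * exp C * exp (\<epsilon> * (cmod z)\<^sup>2)" for z
    using order_trans[OF growth] by (simp add: exp_add mult_ac)
  then show "\<exists>A. \<forall>z. cmod (F z) \<le> A * exp (\<epsilon> * (cmod z)\<^sup>2)" by blast
qed

text \<open>Reduces hyperbolicity to a question about points: any \<open>w\<close> that the chain estimates allow as a nonreal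
  zero of the \<open>n\<close>-th derivative, starting from a zero \<open>w\<^sub>0\<close> of \<open>F\<close>, has to satisfy the criterion of
  \<open>real_rooted_diffop\<close>. The criterion is applied to polynomial approximations of \<open>F\<close>, whose
  derivatives at \<open>0\<close> converge to those of \<open>F\<close>.\<close>

lemma hyperbolic_jensen_poly_of_derivative:
  fixes x :: real
  assumes F: "F holomorphic_on UNIV" "conj_symmetric F" "F (of_real x) \<noteq> 0"
    and A: "A > 0" and \<sigma>: "0 < \<sigma>" "\<sigma> < 2" and growth: "\<And>z. cmod (F z) \<le> A * exp (cmod z powr \<sigma>)"
  obtains n\<^sub>0 where "\<And>n d. \<lbrakk>n \<ge> n\<^sub>0;
      \<And>w w\<^sub>0. \<lbrakk>F w\<^sub>0 = 0; \<bar>Im w\<bar> \<le> \<bar>Im w\<^sub>0\<bar>; cmod (w - w\<^sub>0) \<le> sqrt (2 * real n) * \<bar>Im w\<^sub>0\<bar>;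
          real n powr (1 / \<sigma>) < 10 * (\<bar>x\<bar> + cmod w + 2 * sqrt (2 * real n) * \<bar>Im w\<^sub>0\<bar>)\<rbrakk>
        \<Longrightarrow> (real d - 1) * (Im w)\<^sup>2 \<le> (Re w)\<^sup>2\<rbrakk>
      \<Longrightarrow> hyperbolic (jensen_poly ((deriv ^^ n) F) d)"
proof -
  have sub: "subquadratic_growth F"
    using growth \<sigma> by (rule subquadratic_growthI)
  obtain n0 where n0: "\<And>n p w. \<lbrakk>n \<ge> n0; real_coeffs p;
      \<And>z. cmod z \<le> real n powr (1 / \<sigma>) \<Longrightarrow> cmod (F z - poly p z) \<le> min A (cmod (F x) / 2);
      (pderiv ^^ n) p \<noteq> 0; poly ((pderiv ^^ n) p) w = 0; Im w \<noteq> 0\<rbrakk> \<Longrightarrow>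
      \<exists>w\<^sub>0. poly p w\<^sub>0 = 0 \<and> Im w\<^sub>0 \<noteq> 0 \<and> \<bar>Im w\<bar> \<le> \<bar>Im w\<^sub>0\<bar> \<and>
        cmod (w - w\<^sub>0) \<le> sqrt (2 * real n) * \<bar>Im w\<^sub>0\<bar> \<and>
        real n powr (1 / \<sigma>) < 10 * (cmod (of_real x) + cmod w + 2 * sqrt (2 * real n) * \<bar>Im w\<^sub>0\<bar>)"
    using nonreal_zero_location[of A \<sigma> F "of_real x"] A \<sigma> growth F(3) by blast
  show ?thesis
  proof (rule that[of n0])
    fix n d
    assume n: "n \<ge> n0" and loc: "\<And>w w\<^sub>0. \<lbrakk>F w\<^sub>0 = 0; \<bar>Im w\<bar> \<le> \<bar>Im w\<^sub>0\<bar>; cmod (w - w\<^sub>0) \<le> sqrt (2 * real n) * \<bar>Im w\<^sub>0\<bar>;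
          real n powr (1 / \<sigma>) < 10 * (\<bar>x\<bar> + cmod w + 2 * sqrt (2 * real n) * \<bar>Im w\<^sub>0\<bar>)\<rbrakk>
        \<Longrightarrow> (real d - 1) * (Im w)\<^sup>2 \<le> (Re w)\<^sup>2"
    define S where "S = max 1 (real n powr (1 / \<sigma>))"
    define e where "e j = min (min A (cmod (F x) / 2)) (1 / real (Suc j))" for j
    have epos: "e j > 0" for j using A F(3) by (simp add: e_def)
    have "\<exists>p. real_coeffs p \<and> (\<forall>z. poly p z = 0 \<longrightarrow> Im z \<noteq> 0 \<longrightarrow> F z = 0) \<and>
        (\<forall>z. cmod z \<le> S \<longrightarrow> cmod (F z - poly p z) \<le> e j)" for j
    proof -
      have "S > 0" by (simp add: S_def)
      then show ?thesis
        using polynomial_approximation[OF F sub _ epos] by metis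
    qed
    then obtain p where p: "\<And>j. real_coeffs (p j)" "\<And>j z. poly (p j) z = 0 \<Longrightarrow> Im z \<noteq> 0 \<Longrightarrow> F z = 0"
      "\<And>j z. cmod z \<le> S \<Longrightarrow> cmod (F z - poly (p j) z) \<le> e j"
      by metis
    have lim: "(\<lambda>j. (deriv ^^ m) (poly (p j)) 0) \<longlonglongrightarrow> (deriv ^^ m) F 0" for m
    proof -
      have "cmod ((deriv ^^ m) F 0 - (deriv ^^ m) (poly (p j)) 0) \<le> fact m * (1 / real (Suc j))" for j
      proof -
        have hol: "poly (p j) holomorphic_on UNIV" by (intro holomorphic_intros)
        have "cmod ((deriv ^^ m) (\<lambda>z. F z - poly (p j) z) 0) \<le> fact m * (1 / real (Suc j)) / 1 ^ m"
        proof (rule Cauchy_inequality)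
          fix z :: complex assume "cmod (0 - z) = 1"
          then have "cmod (F z - poly (p j) z) \<le> e j"
            by (intro p(3)) (simp add: S_def)
          then show "cmod (F z - poly (p j) z) \<le> 1 / real (Suc j)"
            by (simp add: e_def)
        next
          show "(\<lambda>z. F z - poly (p j) z) holomorphic_on ball 0 1"
            using F(1) hol by (auto intro!: holomorphic_intros intro: holomorphic_on_subset)
          have "(\<lambda>z. F z - poly (p j) z) holomorphic_on UNIV"
            using F(1) hol by (auto intro!: holomorphic_intros)
          then show "continuous_on (cball 0 1) (\<lambda>z. F z - poly (p j) z)"
            by (meson continuous_on_subset holomorphic_on_imp_continuous_on subset_UNIV)
        qed simp
        moreover have "(deriv ^^ m) (\<lambda>z. F z - poly (p j) z) 0 = (deriv ^^ m) F 0 - (deriv ^^ m) (poly (p j)) 0"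
          using F(1) hol by (intro higher_deriv_diff[of _ UNIV]) auto
        ultimately show ?thesis by simp
      qed
      moreover have "(\<lambda>j. fact m * (1 / real (Suc j))) \<longlonglongrightarrow> fact m * 0"
        by (intro tendsto_mult tendsto_const LIMSEQ_Suc lim_1_over_n)
      ultimately have "(\<lambda>j. (deriv ^^ m) F 0 - (deriv ^^ m) (poly (p j)) 0) \<longlonglongrightarrow> 0"
        using Lim_null_comparison[OF always_eventually] by (metis (no_types, lifting) mult_zero_right)
      then have "(\<lambda>j. (deriv ^^ m) F 0 - ((deriv ^^ m) F 0 - (deriv ^^ m) (poly (p j)) 0))
          \<longlonglongrightarrow> (deriv ^^ m) F 0 - 0"
        by (intro tendsto_diff tendsto_const)
      then show ?thesis by simp
    qed
    show "hyperbolic (jensen_poly ((deriv ^^ n) F) d)"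
    proof (rule hyperbolic_jensen_poly_limit)
      fix j
      define q where "q = (pderiv ^^ n) (p j)"
      have q: "poly q = (deriv ^^ n) (poly (p j))" by (simp add: q_def deriv_poly)
      have "diffop q (monom 1 d) = 0 \<or> real_rooted (diffop q (monom 1 d))"
      proof (cases "q = 0")
        case False
        show ?thesis
        proof (rule real_rooted_diffop)
          show "real_coeffs q" unfolding q_def by (rule real_coeffs_higher_pderiv[OF p(1)])
          show "real_rooted (monom 1 d)" by (simp add: real_rooted_def poly_monom)
          show "degree (monom 1 d :: complex poly) \<le> d" by (rule degree_monom_le)
          fix w assume w: "poly q w = 0" "Im w \<noteq> 0"
          have "cmod (F z - poly (p j) z) \<le> min A (cmod (F x) / 2)"
            if "cmod z \<le> real n powr (1 / \<sigma>)" for z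
            using p(3)[of z j] that by (simp add: S_def e_def)
          from n0[OF n p(1) this False[unfolded q_def] w[unfolded q_def]]
          obtain w\<^sub>0 where "poly (p j) w\<^sub>0 = 0" "Im w\<^sub>0 \<noteq> 0" "\<bar>Im w\<bar> \<le> \<bar>Im w\<^sub>0\<bar>"
            "cmod (w - w\<^sub>0) \<le> sqrt (2 * real n) * \<bar>Im w\<^sub>0\<bar>"
            "real n powr (1 / \<sigma>) < 10 * (\<bar>x\<bar> + cmod w + 2 * sqrt (2 * real n) * \<bar>Im w\<^sub>0\<bar>)"
            by auto
          then show "(real d - 1) * (Im w)\<^sup>2 \<le> (Re w)\<^sup>2"
            using loc p(2) by blast
        qed
      qed (simp add: diffop_0)
      then show "vertically_monotone (appell_poly (\<lambda>k. (deriv ^^ k) ((deriv ^^ n) (poly (p j))) 0) d)"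
        using real_rooted_imp_vertically_monotone unfolding diffop_monom_eq_appell_poly q by blast
    next
      fix k
      have *: "(deriv ^^ k) ((deriv ^^ n) g) 0 = (deriv ^^ (k + n)) g 0" for g :: "complex \<Rightarrow> complex"
        by (simp add: funpow_add)
      show "(\<lambda>j. (deriv ^^ k) ((deriv ^^ n) (poly (p j))) 0) \<longlonglongrightarrow> (deriv ^^ k) ((deriv ^^ n) F) 0"
        unfolding * by (rule lim)
      have "(fact m :: complex) \<in> \<real>" for m
        by (metis of_nat_fact Reals_of_nat)
      then have "(deriv ^^ (k + n)) (poly (p j)) 0 \<in> \<real>" for j
        using p(1)[of j] unfolding deriv_poly higher_pderiv_at_0 real_coeffs_def
        by (intro Reals_mult) auto
      then show "(deriv ^^ k) ((deriv ^^ n) F) 0 \<in> \<real>"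
        unfolding * using real_lim_sequentially[OF lim] by blast
    qed
  qed
qed

section \<open>Growth and symmetry of the given function\<close>

lemma real_entire_conj_symmetric:
  assumes "real_entire f"
  shows "conj_symmetric f"
  unfolding conj_symmetric_def
proof
  fix z
  have hol: "f holomorphic_on ball 0 (cmod z + 1)"
    using assms by (auto simp: real_entire_def intro: holomorphic_on_subset)
  have ser: "(\<lambda>n. (deriv ^^ n) f 0 / fact n * (w - 0) ^ n) sums f w" if "cmod w = cmod z" for w
    using holomorphic_power_series[OF hol, of w] that by simp
  have summand: "cnj ((deriv ^^ n) f 0 / fact n * (z - 0) ^ n) = (deriv ^^ n) f 0 / fact n * (cnj z - 0) ^ n" for n
    using assms by (simp add: real_entire_def Reals_cnj_iff)
  have "(\<lambda>n. cnj ((deriv ^^ n) f 0 / fact n * (z - 0) ^ n)) sums cnj (f z)"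
    using ser[of z] by (subst sums_cnj) simp
  then have "(\<lambda>n. (deriv ^^ n) f 0 / fact n * (cnj z - 0) ^ n) sums cnj (f z)"
    unfolding summand .
  moreover have "(\<lambda>n. (deriv ^^ n) f 0 / fact n * (cnj z - 0) ^ n) sums f (cnj z)"
    by (rule ser) simp
  ultimately show "f (cnj z) = cnj (f z)"
    by (metis sums_unique2)
qed

text \<open>Approximations are centred at a point where the function does not vanish, and a real point keeps them
  real.\<close>

lemma nonzero_at_real_point:
  assumes "F holomorphic_on UNIV" "F z\<^sub>0 \<noteq> 0"
  obtains x :: real where "F (of_real x) \<noteq> 0"
proof (rule ccontr)
  note found = that
  assume none: "\<not> thesis"
  have zero: "F z = 0" if "z \<in> \<real>" for z
    using that found none by (auto elim: Reals_cases)
  have "(0::complex) islimpt \<real>"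
    unfolding islimpt_approachable
  proof (intro allI impI)
    fix e :: real assume "e > 0"
    then show "\<exists>x'\<in>\<real>. x' \<noteq> (0::complex) \<and> dist x' 0 < e"
      by (intro bexI[of _ "of_real (e / 2)"]) (auto simp: norm_divide)
  qed
  then have "F z\<^sub>0 = 0"
    using analytic_continuation[of F UNIV \<real> 0 z\<^sub>0] assms(1) zero by auto
  then show False using assms(2) by simp
qed

text \<open>The factor \<open>exp 1\<close> absorbs the radii at which \<open>ln (max_modulus r f)\<close> is at most \<open>1\<close>; at the others the
  iterated logarithm is that of a number above \<open>1\<close>, and its bound can be exponentiated.\<close>

lemma growth_from_order:
  assumes f: "f holomorphic_on UNIV" and c: "growth_order f < ereal c"
  obtains r\<^sub>0 where "r\<^sub>0 \<ge> 1" "\<And>z. cmod z \<ge> r\<^sub>0 \<Longrightarrow> cmod (f z) \<le> exp 1 * exp (cmod z powr c)"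
proof -
  have "\<forall>\<^sub>F r in at_top. ereal (ln (ln (max_modulus r f)) / ln r) < ereal c"
    using c unfolding growth_order_def by (rule Limsup_lessD)
  then obtain r1 where r1: "\<And>r. r \<ge> r1 \<Longrightarrow> ln (ln (max_modulus r f)) / ln r < c"
    by (auto simp: eventually_at_top_linorder)
  show ?thesis
  proof (rule that[of "max 2 r1"])
    fix z assume z: "max 2 r1 \<le> cmod z"
    define r where "r = cmod z"
    define M where "M = max_modulus r f"
    have r: "r \<ge> 2" "r \<ge> r1" using z by (auto simp: r_def)
    have "compact ((\<lambda>z. cmod (f z)) ` sphere 0 r)"
      using holomorphic_on_imp_continuous_on[OF f]
      by (intro compact_continuous_image continuous_on_norm) (auto intro: continuous_on_subset)
    then have "bdd_above ((\<lambda>z. cmod (f z)) ` sphere 0 r)"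
      by (intro bounded_imp_bdd_above compact_imp_bounded)
    then have fM: "cmod (f z) \<le> M"
      unfolding M_def max_modulus_def by (intro cSUP_upper) (auto simp: r_def)
    have "M \<le> exp 1 * exp (r powr c)"
    proof (cases "M \<le> exp 1")
      case True
      also have "exp 1 * 1 \<le> exp 1 * exp (r powr c)"
        by (intro mult_left_mono) auto
      finally show ?thesis by simp
    next
      case False
      have Mpos: "M > 0" using False by (smt (verit) exp_gt_zero)
      have lM: "ln M > 1"
      proof -
        have "ln (exp 1) < ln M"
          using False Mpos by (subst ln_less_cancel_iff) auto
        then show ?thesis by simp
      qed
      have "ln (ln M) < c * ln r"
        using r1[OF r(2)] r(1) by (simp add: M_def field_simps)
      then have "exp (ln (ln M)) < exp (c * ln r)" by simp
      then have "ln M < r powr c"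
        using lM r(1) by (simp add: powr_def)
      then have "exp (ln M) < exp (r powr c)" by simp
      then have "M < exp (r powr c)" using Mpos by simp
      also have "\<dots> \<le> exp 1 * exp (r powr c)" by simp
      finally show ?thesis by simp
    qed
    then show "cmod (f z) \<le> exp 1 * exp (cmod z powr c)"
      using fM by (simp add: r_def)
  qed simp
qed

text \<open>Otherwise \<open>f\<close> would be bounded, and constant by Liouville's theorem.\<close>

lemma order_exponent_positive:
  assumes f: "f holomorphic_on UNIV" "transcendental f" and c: "growth_order f < ereal c"
  shows "c > 0"
proof (rule ccontr)
  assume "\<not> c > 0"
  obtain r0 where r0: "r0 \<ge> 1" "\<And>z. cmod z \<ge> r0 \<Longrightarrow> cmod (f z) \<le> exp 1 * exp (cmod z powr c)"
    using growth_from_order[OF f(1) c] by blast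
  obtain K where K: "K > 0" "\<And>z. cmod z \<le> r0 \<Longrightarrow> cmod (f z) \<le> K"
    using continuous_bound_on_cball[OF holomorphic_on_imp_continuous_on[OF f(1)]] by blast
  have "cmod (f z) \<le> max K (exp 1 * exp 1)" for z
  proof (cases "cmod z \<le> r0")
    case True
    then show ?thesis using K(2) by (simp add: le_max_iff_disj)
  next
    case False
    then have "cmod z powr c \<le> 1 powr c"
      using r0(1) \<open>\<not> c > 0\<close> by (intro powr_mono2') auto
    then have "exp 1 * exp (cmod z powr c) \<le> exp 1 * exp (1::real)" by simp
    with r0(2)[of z] False have "cmod (f z) \<le> exp 1 * exp 1" by linarith
    then show ?thesis by (rule max.coboundedI2)
  qed
  then have "bounded (range f)"
    unfolding bounded_iff by blast
  then obtain k where "\<And>z. f z = k"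
    using Liouville_theorem[OF f(1)] by (auto simp: constant_on_def)
  then have "f = poly [:k:]" by auto
  then show False using f(2) by (auto simp: transcendental_def)
qed

lemma growth_bound:
  assumes f: "f holomorphic_on UNIV" and c: "growth_order f < ereal c"
  obtains A where "A > 0" "\<And>z. cmod (f z) \<le> A * exp (cmod z powr c)"
proof -
  obtain r0 where r0: "r0 \<ge> 1" "\<And>z. cmod z \<ge> r0 \<Longrightarrow> cmod (f z) \<le> exp 1 * exp (cmod z powr c)"
    using growth_from_order[OF f c] by blast
  obtain K where K: "K > 0" "\<And>z. cmod z \<le> r0 \<Longrightarrow> cmod (f z) \<le> K"
    using continuous_bound_on_cball[OF holomorphic_on_imp_continuous_on[OF f(1)]] by blast
  show ?thesis
  proof (rule that[of "max K (exp 1)"])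
    show "max K (exp 1) > 0" using K by simp
    fix z
    show "cmod (f z) \<le> max K (exp 1) * exp (cmod z powr c)"
    proof (cases "cmod z \<le> r0")
      case True
      have "cmod (f z) \<le> max K (exp 1) * 1" using K(2)[OF True] by simp
      also have "\<dots> \<le> max K (exp 1) * exp (cmod z powr c)"
        using K(1) by (intro mult_left_mono) auto
      finally show ?thesis .
    next
      case False
      then have "cmod (f z) \<le> exp 1 * exp (cmod z powr c)" using r0 by simp
      also have "\<dots> \<le> max K (exp 1) * exp (cmod z powr c)"
        by (intro mult_right_mono) auto
      finally show ?thesis .
    qed
  qed
qed

section \<open>The bounds for functions with zeros in a strip or in a parabolic region\<close>

lemma jensen_N_bigo:
  assumes hyp: "\<And>n d. n \<ge> n\<^sub>0 \<Longrightarrow> K * real d powr s \<le> real n \<Longrightarrow> hyperbolic (jensen_poly ((deriv ^^ n) F) d)"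
    and s: "0 < s" "s \<le> t" and K: "K \<ge> 0"
  shows "enat_bigo (jensen_N F) (\<lambda>d. real d powr t)"
proof -
  define N where "N d = n\<^sub>0 + nat \<lceil>K * real d powr s\<rceil>" for d
  have ex: "hyperbolic_from F d (N d)" for d
    unfolding hyperbolic_from_def
  proof (intro allI impI)
    fix n assume n: "N d \<le> n"
    have "K * real d powr s \<le> real (nat \<lceil>K * real d powr s\<rceil>)"
      by (rule real_nat_ceiling_ge)
    also have "\<dots> \<le> real n" using n unfolding N_def of_nat_le_iff by linarith
    finally show "hyperbolic (jensen_poly ((deriv ^^ n) F) d)"
      using hyp n by (simp add: N_def)
  qed
  have J: "jensen_N F d = enat (LEAST N. hyperbolic_from F d N)" for d
    using ex unfolding jensen_N_def by auto
  have le: "the_enat (jensen_N F d) \<le> N d" for d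
    unfolding J using ex by (simp add: Least_le)
  have "\<forall>\<^sub>F d in sequentially.
      norm (real (the_enat (jensen_N F d))) \<le> (real n\<^sub>0 + K + 1) * norm (real d powr t)"
    using eventually_ge_at_top[of 1]
  proof eventually_elim
    case (elim d)
    have d1: "1 \<le> real d powr t"
      using elim s by (intro ge_one_powr_ge_zero) auto
    have "real d powr s \<le> real d powr t"
      using elim s by (intro powr_mono) auto
    then have Kd: "K * real d powr s \<le> K * real d powr t"
      using K by (intro mult_left_mono) auto
    have nn: "0 \<le> K * real d powr s" using K by simp
    have "real (the_enat (jensen_N F d)) \<le> real (N d)" using le by simp
    also have "\<dots> \<le> real n\<^sub>0 + (K * real d powr s + 1)"
      unfolding N_def using nn by simp
    also have "\<dots> \<le> real n\<^sub>0 * real d powr t + (K * real d powr t + 1 * real d powr t)"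
      using Kd d1 mult_left_mono[OF d1, of "real n\<^sub>0"] by simp
    also have "\<dots> = (real n\<^sub>0 + K + 1) * real d powr t" by (simp add: algebra_simps)
    finally show ?case by simp
  qed
  then show ?thesis
    unfolding enat_bigo_def by (auto simp: J intro: bigoI)
qed

lemma powr_dominates_nat:
  assumes "0 \<le> a" "a < (b::real)"
  obtains n\<^sub>1 where "\<And>n. n \<ge> n\<^sub>1 \<Longrightarrow> C * real n powr a \<le> real n powr b"
    "\<And>n. n \<ge> n\<^sub>1 \<Longrightarrow> \<bar>C\<bar> \<le> real n powr b"
proof -
  have "\<forall>\<^sub>F t in at_top. t powr a \<le> 1 / (\<bar>C\<bar> + 1) * t powr b"
    using assms(2) by (intro powr_dominates) auto
  then have "\<forall>\<^sub>F n in sequentially. real n powr a \<le> 1 / (\<bar>C\<bar> + 1) * real n powr b"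
    using filterlim_real_sequentially by (rule eventually_compose_filterlim)
  then obtain n1 where n1: "\<And>n. n \<ge> n1 \<Longrightarrow> real n powr a \<le> 1 / (\<bar>C\<bar> + 1) * real n powr b"
    by (auto simp: eventually_sequentially)
  have abs: "\<bar>C\<bar> * real n powr a \<le> real n powr b" if "n \<ge> n1" for n
  proof -
    have "\<bar>C\<bar> * real n powr a \<le> (\<bar>C\<bar> + 1) * real n powr a"
      by (intro mult_right_mono) auto
    also have "\<dots> \<le> real n powr b"
      using n1[OF that] by (simp add: field_simps)
    finally show ?thesis .
  qed
  show ?thesis
  proof (rule that[of "max 1 n1"])
    fix n assume n: "max 1 n1 \<le> n"
    have "C * real n powr a \<le> \<bar>C\<bar> * real n powr a"
      by (intro mult_right_mono) auto
    also have "\<dots> \<le> real n powr b"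
      using abs[of n] n by simp
    finally show "C * real n powr a \<le> real n powr b" .
    have "1 \<le> real n powr a"
      using n assms(1) by (intro ge_one_powr_ge_zero) auto
    then have "\<bar>C\<bar> * 1 \<le> \<bar>C\<bar> * real n powr a"
      by (intro mult_left_mono) auto
    then show "\<bar>C\<bar> \<le> real n powr b"
      using abs[of n] n by simp
  qed
qed

text \<open>For heights below \<open>1/2\<close> the location estimate gives \<open>|w| \<ge> n\<^sup>1\<^sup>/\<^sup>\<sigma> / 20\<close>, since \<open>\<surd>n\<close> and \<open>|x|\<close> are
  negligible. The constant \<open>40\<^sup>\<sigma>\<close> turns this into \<open>|w| \<ge> 2 \<surd>d\<close>, which is enough for heights at most
  \<open>1/2\<close>.\<close>

lemma strip_hyperbolic:
  assumes F: "F holomorphic_on UNIV" "conj_symmetric F" "F z\<^sub>0 \<noteq> 0"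
    and A: "A > 0" and \<sigma>: "0 < \<sigma>" "\<sigma> < 2" and growth: "\<And>z. cmod (F z) \<le> A * exp (cmod z powr \<sigma>)"
    and strip: "\<And>z. F z = 0 \<Longrightarrow> \<bar>Im z\<bar> < 1 / 2"
  obtains n\<^sub>1 where "\<And>n d. n \<ge> n\<^sub>1 \<Longrightarrow> 40 powr \<sigma> * real d powr (\<sigma> / 2) \<le> real n \<Longrightarrow>
      hyperbolic (jensen_poly ((deriv ^^ n) F) d)"
proof -
  obtain x :: real where x: "F (of_real x) \<noteq> 0"
    using nonzero_at_real_point[OF F(1,3)] by blast
  obtain n0 where n0: "\<And>n d. \<lbrakk>n \<ge> n0;
      \<And>w w\<^sub>0. \<lbrakk>F w\<^sub>0 = 0; \<bar>Im w\<bar> \<le> \<bar>Im w\<^sub>0\<bar>; cmod (w - w\<^sub>0) \<le> sqrt (2 * real n) * \<bar>Im w\<^sub>0\<bar>;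
          real n powr (1 / \<sigma>) < 10 * (\<bar>x\<bar> + cmod w + 2 * sqrt (2 * real n) * \<bar>Im w\<^sub>0\<bar>)\<rbrakk>
        \<Longrightarrow> (real d - 1) * (Im w)\<^sup>2 \<le> (Re w)\<^sup>2\<rbrakk>
      \<Longrightarrow> hyperbolic (jensen_poly ((deriv ^^ n) F) d)"
    using hyperbolic_jensen_poly_of_derivative[OF F(1,2) x A \<sigma> growth] by blast
  have "1 / 2 < 1 / \<sigma>" using \<sigma> by (auto simp: field_simps)
  then obtain n1 where n1: "\<And>n. n \<ge> n1 \<Longrightarrow> (160 + 40 * \<bar>x\<bar>) * real n powr (1/2) \<le> real n powr (1 / \<sigma>)"
    "\<And>n. n \<ge> n1 \<Longrightarrow> \<bar>160 + 40 * \<bar>x\<bar>\<bar> \<le> real n powr (1 / \<sigma>)"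
    using powr_dominates_nat[of "1/2" "1 / \<sigma>" "160 + 40 * \<bar>x\<bar>"] by auto
  show ?thesis
  proof (rule that[of "max 1 (max n0 n1)"])
    fix n d :: nat
    assume n: "max 1 (max n0 n1) \<le> n" and nd: "40 powr \<sigma> * real d powr (\<sigma> / 2) \<le> real n"
    define T where "T = real n powr (1 / \<sigma>)"
    have "160 * sqrt (real n) \<le> (160 + 40 * \<bar>x\<bar>) * sqrt (real n)"
      by (intro mult_right_mono) auto
    also have "\<dots> \<le> T"
      using n1(1)[of n] n by (simp add: T_def powr_half_sqrt)
    finally have sq: "160 * sqrt (real n) \<le> T" .
    have xT: "40 * \<bar>x\<bar> \<le> T"
      using n1(2)[of n] n by (simp add: T_def)
    have Td: "40 * sqrt (real d) \<le> T"
    proof -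
      have "(40 powr \<sigma> * real d powr (\<sigma> / 2)) powr (1 / \<sigma>) \<le> T"
        unfolding T_def using nd \<sigma> by (intro powr_mono2) auto
      moreover have "(40 powr \<sigma> * real d powr (\<sigma> / 2)) powr (1 / \<sigma>) = 40 * sqrt (real d)"
        using \<sigma> by (simp add: powr_mult powr_powr powr_half_sqrt)
      ultimately show ?thesis by simp
    qed
    show "hyperbolic (jensen_poly ((deriv ^^ n) F) d)"
    proof (rule n0)
      show "n \<ge> n0" using n by simp
      fix w w\<^sub>0
      assume w0: "F w\<^sub>0 = 0" "\<bar>Im w\<bar> \<le> \<bar>Im w\<^sub>0\<bar>"
        and far: "real n powr (1 / \<sigma>) < 10 * (\<bar>x\<bar> + cmod w + 2 * sqrt (2 * real n) * \<bar>Im w\<^sub>0\<bar>)"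
      have h: "\<bar>Im w\<^sub>0\<bar> \<le> 1 / 2" using strip[OF w0(1)] by simp
      have "sqrt (2 * real n) \<le> 2 * sqrt (real n)"
        using real_sqrt_le_mono[of "2 * real n" "4 * real n"] by (simp add: real_sqrt_mult)
      then have "2 * sqrt (2 * real n) * \<bar>Im w\<^sub>0\<bar> \<le> 2 * (2 * sqrt (real n)) * (1 / 2)"
        using h by (intro mult_mono) auto
      then have "T < 10 * (\<bar>x\<bar> + cmod w + 2 * sqrt (real n))"
        using far by (simp add: T_def)
      then have "T < 10 * \<bar>x\<bar> + 10 * cmod w + 20 * sqrt (real n)"
        by (simp only: distrib_left)
      then have "T < 20 * cmod w" using sq xT norm_ge_zero[of w] by linarith
      then have "2 * sqrt (real d) \<le> cmod w" using Td by linarith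
      then have "(2 * sqrt (real d))\<^sup>2 \<le> (cmod w)\<^sup>2" by (intro power_mono) auto
      then have big: "4 * real d \<le> (Re w)\<^sup>2 + (Im w)\<^sup>2"
        by (simp add: cmod_power2 power_mult_distrib)
      have "\<bar>Im w\<bar>\<^sup>2 \<le> (1 / 2)\<^sup>2" using w0(2) h by (intro power_mono) auto
      then have small: "(Im w)\<^sup>2 \<le> 1 / 4" by (simp add: power_divide)
      show "(real d - 1) * (Im w)\<^sup>2 \<le> (Re w)\<^sup>2"
      proof -
        have "real d * (Im w)\<^sup>2 \<le> real d * (1 / 4)"
          using small by (intro mult_left_mono) auto
        then show ?thesis using big by (simp add: left_diff_distrib)
      qed
    qed
  qed
qed

text \<open>Let \<open>h = |Im w\<^sub>0|\<close>. Since \<open>h\<^sup>2 \<le> |w\<^sub>0|\<close>, the displacement \<open>\<surd>(2n) h\<close> is at most \<open>n + |w\<^sub>0| / 2\<close>, so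
  \<open>|w\<^sub>0| \<le> 2 |w| + 2 n\<close>. The location estimate then shows that \<open>|w|\<close> is at least of the order of
  \<open>n\<^sup>1\<^sup>/\<^sup>\<sigma>\<close>, which dominates \<open>n\<close> because \<open>\<sigma> < 1\<close>. Hence \<open>(Im w)\<^sup>2 \<le> h\<^sup>2 \<le> 4 |w|\<close>, and
  \<open>|w| \<ge> 4 d\<close> is enough for the criterion; the constant \<open>240\<^sup>\<sigma>\<close> achieves it.\<close>

lemma parabola_hyperbolic:
  assumes F: "F holomorphic_on UNIV" "conj_symmetric F" "F z\<^sub>0 \<noteq> 0"
    and A: "A > 0" and \<sigma>: "0 < \<sigma>" "\<sigma> < 1" and growth: "\<And>z. cmod (F z) \<le> A * exp (cmod z powr \<sigma>)"
    and parabola: "\<And>z. F z = 0 \<Longrightarrow> (Im z)\<^sup>2 \<le> cmod z"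
  obtains n\<^sub>1 where "\<And>n d. n \<ge> n\<^sub>1 \<Longrightarrow> 240 powr \<sigma> * real d powr \<sigma> \<le> real n \<Longrightarrow>
      hyperbolic (jensen_poly ((deriv ^^ n) F) d)"
proof -
  obtain x :: real where x: "F (of_real x) \<noteq> 0"
    using nonzero_at_real_point[OF F(1,3)] by blast
  have \<sigma>2: "\<sigma> < 2" using \<sigma> by simp
  obtain n0 where n0: "\<And>n d. \<lbrakk>n \<ge> n0;
      \<And>w w\<^sub>0. \<lbrakk>F w\<^sub>0 = 0; \<bar>Im w\<bar> \<le> \<bar>Im w\<^sub>0\<bar>; cmod (w - w\<^sub>0) \<le> sqrt (2 * real n) * \<bar>Im w\<^sub>0\<bar>;
          real n powr (1 / \<sigma>) < 10 * (\<bar>x\<bar> + cmod w + 2 * sqrt (2 * real n) * \<bar>Im w\<^sub>0\<bar>)\<rbrakk>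
        \<Longrightarrow> (real d - 1) * (Im w)\<^sup>2 \<le> (Re w)\<^sup>2\<rbrakk>
      \<Longrightarrow> hyperbolic (jensen_poly ((deriv ^^ n) F) d)"
    using hyperbolic_jensen_poly_of_derivative[OF F(1,2) x A \<sigma>(1) \<sigma>2 growth] by blast
  have "1 < 1 / \<sigma>" using \<sigma> by (auto simp: field_simps)
  then obtain n1 where n1: "\<And>n. n \<ge> n1 \<Longrightarrow> (160 + 40 * \<bar>x\<bar>) * real n powr 1 \<le> real n powr (1 / \<sigma>)"
    "\<And>n. n \<ge> n1 \<Longrightarrow> \<bar>160 + 40 * \<bar>x\<bar>\<bar> \<le> real n powr (1 / \<sigma>)"
    using powr_dominates_nat[of 1 "1 / \<sigma>" "160 + 40 * \<bar>x\<bar>"] by auto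
  show ?thesis
  proof (rule that[of "max 1 (max n0 n1)"])
    fix n d :: nat
    assume n: "max 1 (max n0 n1) \<le> n" and nd: "240 powr \<sigma> * real d powr \<sigma> \<le> real n"
    define T where "T = real n powr (1 / \<sigma>)"
    have "160 * real n \<le> (160 + 40 * \<bar>x\<bar>) * real n"
      by (intro mult_right_mono) auto
    also have "\<dots> \<le> T"
      using n1(1)[of n] n by (simp add: T_def)
    finally have nT: "160 * real n \<le> T" .
    have xT: "40 * \<bar>x\<bar> \<le> T"
      using n1(2)[of n] n by (simp add: T_def)
    have Td: "240 * real d \<le> T"
    proof -
      have "(240 powr \<sigma> * real d powr \<sigma>) powr (1 / \<sigma>) \<le> T"
        unfolding T_def using nd \<sigma> by (intro powr_mono2) auto
      moreover have "(240 powr \<sigma> * real d powr \<sigma>) powr (1 / \<sigma>) = 240 * real d"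
        using \<sigma> by (simp add: powr_mult powr_powr)
      ultimately show ?thesis by simp
    qed
    show "hyperbolic (jensen_poly ((deriv ^^ n) F) d)"
    proof (rule n0)
      show "n \<ge> n0" using n by simp
      fix w w\<^sub>0
      assume w0: "F w\<^sub>0 = 0" "\<bar>Im w\<bar> \<le> \<bar>Im w\<^sub>0\<bar>"
        and near: "cmod (w - w\<^sub>0) \<le> sqrt (2 * real n) * \<bar>Im w\<^sub>0\<bar>"
        and far: "real n powr (1 / \<sigma>) < 10 * (\<bar>x\<bar> + cmod w + 2 * sqrt (2 * real n) * \<bar>Im w\<^sub>0\<bar>)"
      define h where "h = \<bar>Im w\<^sub>0\<bar>"
      have h2: "h\<^sup>2 \<le> cmod w\<^sub>0" using parabola[OF w0(1)] by (simp add: h_def)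
      have amgm: "2 * (sqrt (2 * real n) * h) \<le> 2 * real n + h\<^sup>2"
        using sum_squares_bound[of "sqrt (2 * real n)" h] by simp
      have tri: "cmod w\<^sub>0 \<le> cmod w + cmod (w - w\<^sub>0)"
        using norm_triangle_ineq4[of w "w - w\<^sub>0"] by simp
      have "2 * cmod w\<^sub>0 \<le> 2 * cmod w + 2 * real n + h\<^sup>2"
        using tri near amgm unfolding h_def[symmetric] by linarith
      then have w0w: "cmod w\<^sub>0 \<le> 2 * cmod w + 2 * real n" using h2 by linarith
      have "2 * sqrt (2 * real n) * h \<le> 4 * real n + 2 * cmod w"
        using amgm h2 w0w by simp
      then have "T < 10 * (\<bar>x\<bar> + 3 * cmod w + 4 * real n)"
        using far by (simp add: T_def h_def)
      then have "T < 10 * \<bar>x\<bar> + 30 * cmod w + 40 * real n"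
        by (simp only: distrib_left)
      then have Tw: "T < 60 * cmod w" using nT xT by linarith
      have "cmod w\<^sub>0 \<le> 4 * cmod w" using w0w Tw nT by linarith
      moreover have "\<bar>Im w\<bar>\<^sup>2 \<le> h\<^sup>2" using w0(2) by (intro power_mono) (auto simp: h_def)
      ultimately have Im: "(Im w)\<^sup>2 \<le> 4 * cmod w" using h2 by simp
      have wd: "4 * real d \<le> cmod w" using Tw Td by linarith
      have "real d * (Im w)\<^sup>2 \<le> real d * (4 * cmod w)"
        using Im by (intro mult_left_mono) auto
      also have "\<dots> = 4 * real d * cmod w" by simp
      also have "\<dots> \<le> cmod w * cmod w"
        using wd by (intro mult_right_mono) auto
      also have "\<dots> = (Re w)\<^sup>2 + (Im w)\<^sup>2"
        by (simp add: cmod_power2[symmetric] power2_eq_square[symmetric])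
      finally show "(real d - 1) * (Im w)\<^sup>2 \<le> (Re w)\<^sup>2"
        by (simp add: left_diff_distrib)
    qed
  qed
qed

theorem theorem1:
  fixes f :: "complex \<Rightarrow> complex" and \<rho> :: ereal
  assumes "real_entire f"
    and "transcendental f"
    and "growth_order f = \<rho>"
    and "\<rho> < 2"
    and "zero_set f \<subseteq> {z. \<bar>Im z\<bar> < 1/2}"
  shows "(\<forall>c::real. \<rho> < ereal c \<longrightarrow> enat_bigo (jensen_N f) (\<lambda>d. real d powr (c/2))) \<and>
    ((\<forall>z. f (- z) = f z) \<longrightarrow>
      (\<forall>f\<^sub>0 :: complex \<Rightarrow> complex. f\<^sub>0 holomorphic_on UNIV \<and> (\<forall>z. f z = f\<^sub>0 (z\<^sup>2)) \<longrightarrow>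
        (\<forall>c::real. \<rho> < ereal c \<longrightarrow> enat_bigo (jensen_N f\<^sub>0) (\<lambda>d. real d powr (c/2)))))"
proof -
  have hol: "f holomorphic_on UNIV" using assms(1) by (simp add: real_entire_def)
  have sym: "conj_symmetric f" using assms(1) by (rule real_entire_conj_symmetric)
  have strip: "\<bar>Im z\<bar> < 1 / 2" if "f z = 0" for z
    using assms(5) that by (auto simp: zero_set_def)
  obtain z0 where z0: "f z0 \<noteq> 0"
  proof -
    have "f \<noteq> poly 0" using assms(2) by (auto simp: transcendental_def)
    then show ?thesis using that by (auto simp: fun_eq_iff)
  qed
  have exponent: "\<exists>\<sigma> A. 0 < \<sigma> \<and> \<sigma> < 2 \<and> \<sigma> \<le> c \<and> 0 < A \<and> (\<forall>z. cmod (f z) \<le> A * exp (cmod z powr \<sigma>))"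
    if c: "\<rho> < ereal c" for c
  proof -
    have "\<rho> < ereal (min c 2)" using c assms(4) by (simp add: min_def)
    then obtain \<sigma> where \<sigma>: "\<rho> < ereal \<sigma>" "ereal \<sigma> < ereal (min c 2)"
      using ereal_dense2 by blast
    have "growth_order f < ereal \<sigma>" using \<sigma>(1) assms(3) by simp
    then have "0 < \<sigma>" "\<exists>A. 0 < A \<and> (\<forall>z. cmod (f z) \<le> A * exp (cmod z powr \<sigma>))"
      using order_exponent_positive[OF hol assms(2)] growth_bound[OF hol] by blast+
    moreover have "\<sigma> < 2" "\<sigma> \<le> c" using \<sigma>(2) by auto
    ultimately show ?thesis by blast
  qed
  show ?thesis
  proof (intro conjI allI impI)
    fix c :: real assume "\<rho> < ereal c"
    then obtain \<sigma> A where \<sigma>: "0 < \<sigma>" "\<sigma> < 2" "\<sigma> \<le> c" "0 < A"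
      "\<And>z. cmod (f z) \<le> A * exp (cmod z powr \<sigma>)"
      using exponent by blast
    obtain n1 where "\<And>n d. n \<ge> n1 \<Longrightarrow> 40 powr \<sigma> * real d powr (\<sigma> / 2) \<le> real n \<Longrightarrow>
        hyperbolic (jensen_poly ((deriv ^^ n) f) d)"
      using strip_hyperbolic[OF hol sym z0 \<sigma>(4,1,2,5) strip] by blast
    then show "enat_bigo (jensen_N f) (\<lambda>d. real d powr (c / 2))"
      by (rule jensen_N_bigo[where K = "40 powr \<sigma>" and s = "\<sigma> / 2"]) (use \<sigma> in auto)
  next
    fix f\<^sub>0 :: "complex \<Rightarrow> complex" and c :: real
    assume f0: "f\<^sub>0 holomorphic_on UNIV \<and> (\<forall>z. f z = f\<^sub>0 (z\<^sup>2))" and c: "\<rho> < ereal c"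
    obtain \<sigma> A where \<sigma>: "0 < \<sigma>" "\<sigma> < 2" "\<sigma> \<le> c" "0 < A"
      and A: "\<And>z. cmod (f z) \<le> A * exp (cmod z powr \<sigma>)"
      using exponent[OF c] by blast
    have root: "f\<^sub>0 w = f (csqrt w)" for w using f0 by simp
    have mod: "cmod (csqrt w) = cmod w powr (1 / 2)" for w
      using norm_power[of "csqrt w" 2] by (simp add: powr_half_sqrt real_sqrt_unique)
    have sym0: "conj_symmetric f\<^sub>0"
      unfolding conj_symmetric_def
    proof
      fix w
      have "f\<^sub>0 ((cnj (csqrt w))\<^sup>2) = cnj (f\<^sub>0 ((csqrt w)\<^sup>2))"
        using f0 sym unfolding conj_symmetric_def by metis
      then show "f\<^sub>0 (cnj w) = cnj (f\<^sub>0 w)"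
        by (simp flip: complex_cnj_power)
    qed
    have nz: "f\<^sub>0 (z0\<^sup>2) \<noteq> 0" using z0 f0 by metis
    have growth0: "cmod (f\<^sub>0 w) \<le> A * exp (cmod w powr (\<sigma> / 2))" for w
      using A[of "csqrt w"] unfolding root mod by (simp add: powr_powr)
    have parabola: "(Im w)\<^sup>2 \<le> cmod w" if "f\<^sub>0 w = 0" for w
    proof -
      define v where "v = csqrt w"
      have v: "w = v\<^sup>2" by (simp add: v_def)
      have "\<bar>Im v\<bar> \<le> 1 / 2" using strip[of v] that f0 v by (metis less_imp_le)
      then have "\<bar>Im w\<bar> \<le> 2 * \<bar>Re v\<bar> * (1 / 2)"
        unfolding v Im_power2 abs_mult by (intro mult_mono) auto
      also have "\<dots> \<le> cmod v" using abs_Re_le_cmod[of v] by simp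
      finally have "\<bar>Im w\<bar>\<^sup>2 \<le> (cmod v)\<^sup>2" by (intro power_mono) auto
      then show ?thesis by (simp add: v norm_power)
    qed
    obtain n1 where "\<And>n d. n \<ge> n1 \<Longrightarrow> 240 powr (\<sigma> / 2) * real d powr (\<sigma> / 2) \<le> real n \<Longrightarrow>
        hyperbolic (jensen_poly ((deriv ^^ n) f\<^sub>0) d)"
      using parabola_hyperbolic[of f\<^sub>0 "z0\<^sup>2" A "\<sigma> / 2"] f0 sym0 nz \<sigma> growth0 parabola by auto
    then show "enat_bigo (jensen_N f\<^sub>0) (\<lambda>d. real d powr (c / 2))"
      by (rule jensen_N_bigo[where K = "240 powr (\<sigma> / 2)" and s = "\<sigma> / 2"]) (use \<sigma> in auto)
  qed
qed

end
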